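(* For every completely regular frame $L$, the $\sigma$-frame $\mathrm{Coz}_c[L]=\{\mathrm{coz}(\alpha)\mid \alpha\in\mathcal C_c(L)\}$ (with the order inherited from $L$) is normal and perfectly normal.
   Context: Let $L$ be a frame with top $\top$ and bottom $\bot$. The frame of reals $\mathcal L(\mathbb R)$ is generated by pairs $(p,q)$, $p,q\in\mathbb Q$, subject to: (R1) $(p,q)\wedge(r,s)=(p\vee r,q\wedge s)$; (R2) $(p,q)\vee(r,s)=(p,s)$ whenever $p\le r<q\le s$; (R3) $(p,q)=\bigvee\{(r,s)\mid p<r<s<q\}$; (R4) $\top=\bigvee\{(p,q)\mid p,q\in\mathbb Q\}$. $\mathcal R(L)$ is the set of frame homomorphisms $\mathcal L(\mathbb R)\to L$; it is an $f$-ring with operations, for $\diamond\in\{+,\cdot,\wedge,\vee\}$, $(\alpha\diamond\beta)(p,q)=\bigvee\{\alpha(r,s)\wedge\beta(u,v)\mid \langle r,s\rangle\diamond\langle u,v\rangle\subseteq\langle p,q\rangle\}$, where $\langle p,q\rangle=\{t\in\mathbb R\mid p<t<q\}$. For $r\in\mathbb R$, the constant $\mathbf r\in\mathcal R(L)$ satisfies $\mathbf r(p,q)=\top$ if $p<r<q$ and $\bot$ otherwise; $\alpha-r$ means $\alpha-\mathbf r$. Put $(p,-)=\bigvee_{r,s>p}(r,s)$ and $(-,q)=\bigvee_{r,s<q}(r,s)$ (with $r,s\in\mathbb Q$). The cozero element of $\alpha$ is $\mathrm{coz}(\alpha)=\alpha(-,0)\vee\alpha(0,-)$. Put $R_\alpha=\{r\in\mathbb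 R\mid \mathrm{coz}(\alpha-r)\ne\top\}$ and $\mathcal C_c(L)=\{\alpha\in\mathcal R(L)\mid R_\alpha\text{ is countable}\}$ (countable includes finite). $L$ is completely regular iff every element of $L$ is the join of elements of the form $\mathrm{coz}(\alpha)$, $\alpha\in\mathcal R(L)$. A $\sigma$-frame is a distributive lattice $M$ in which every countable subset has a join and $a\wedge\bigvee S=\bigvee_{s\in S}(a\wedge s)$ for all $a\in M$ and countable $S\subseteq M$. A bounded lattice $M$ is normal if whenever $a,b\in M$ satisfy $a\vee b=\top$ there exist $u,v\in M$ with $a\vee u=\top=v\vee b$ and $u\wedge v=\bot$. A normal $\sigma$-frame $M$ is perfectly normal if for each $a\in M$ there is a sequence $(a_n)_{n=1}^\infty$ in $M$ such that for all $b,c\in M$: $a\wedge b=a\wedge c$ if and only if $a_n\vee b=a_n\vee c$ for every $n$. *)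

theory Defs
  imports Complex_Main "HOL-Library.Countable_Set" "HOL-Algebra.Lattice"
begin

text \<open>The short names \<open>sup\<close>, \<open>inf\<close>, \<open>top\<close> below always denote the type class operations; the
  operations of an explicit order structure \<open>M\<close> are written with an index, e.g. \<open>x \<squnion>\<^bsub>M\<^esub> y\<close>.\<close>

hide_const (open) Lattice.sup Lattice.inf Order.top

section \<open>Frames\<close>

class frame = complete_lattice +
  assumes inf_Sup_frame: "inf a (Sup S) = Sup (inf a ` S)"

definition frame_hom :: "('a::frame \<Rightarrow> 'b::frame) \<Rightarrow> bool" where
  "frame_hom h \<longleftrightarrow>
     h top = top \<and> (\<forall>x y. h (inf x y) = inf (h x) (h y)) \<and> (\<forall>S. h (Sup S) = Sup (h ` S))"


section \<open>The frame of reals\<close>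

text \<open>The defining relations, for a family of elements of a frame indexed by pairs of rationals.\<close>

definition real_relations :: "(rat \<Rightarrow> rat \<Rightarrow> 'a::frame) \<Rightarrow> bool" where
  "real_relations f \<longleftrightarrow>
     (\<forall>p q r s. inf (f p q) (f r s) = f (max p r) (min q s)) \<and>
     (\<forall>p q r s. p \<le> r \<and> r < q \<and> q \<le> s \<longrightarrow> sup (f p q) (f r s) = f p s) \<and>
     (\<forall>p q. f p q = Sup {f r s | r s. p < r \<and> r < s \<and> s < q}) \<and>
     top = Sup {f p q | p q. True}"

text \<open>The frame presented by these generators and relations, in its usual concrete form: by the
  first and fourth relation every element is a join of generators, so it is represented by the set
  of all pairs \<open>(p, q)\<close> whose generator lies below it. The three closure conditions reflect the first
  three relations, in this order.
  That this is indeed the presented frame is the content of \<open>real_relations_gen\<close>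
  and \<open>universal_property\<close> below.\<close>

definition real_ideal :: "(rat \<times> rat) set \<Rightarrow> bool" where
  "real_ideal U \<longleftrightarrow>
     (\<forall>p q r s. (p, q) \<in> U \<longrightarrow> p \<le> r \<longrightarrow> s \<le> q \<longrightarrow> (r, s) \<in> U) \<and>
     (\<forall>p q r s. p \<le> r \<longrightarrow> r < q \<longrightarrow> q \<le> s \<longrightarrow> (p, q) \<in> U \<longrightarrow> (r, s) \<in> U \<longrightarrow> (p, s) \<in> U) \<and>
     (\<forall>p q. (\<forall>r s. p < r \<longrightarrow> r < s \<longrightarrow> s < q \<longrightarrow> (r, s) \<in> U) \<longrightarrow> (p, q) \<in> U)"

lemma real_ideal_down: "real_ideal U \<Longrightarrow> (p, q) \<in> U \<Longrightarrow> p \<le> r \<Longrightarrow> s \<le> q \<Longrightarrow> (r, s) \<in> U"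
  unfolding real_ideal_def by blast

lemma real_ideal_glue:
  "real_ideal U \<Longrightarrow> (p, q) \<in> U \<Longrightarrow> (r, s) \<in> U \<Longrightarrow> p \<le> r \<Longrightarrow> r < q \<Longrightarrow> q \<le> s \<Longrightarrow> (p, s) \<in> U"
  unfolding real_ideal_def by blast

lemma real_ideal_inner:
  "real_ideal U \<Longrightarrow> (\<And>r s. p < r \<Longrightarrow> r < s \<Longrightarrow> s < q \<Longrightarrow> (r, s) \<in> U) \<Longrightarrow> (p, q) \<in> U"
  unfolding real_ideal_def by blast

lemma real_ideal_empty_interval: "real_ideal U \<Longrightarrow> q \<le> p \<Longrightarrow> (p, q) \<in> U"
  by (rule real_ideal_inner) auto

lemma real_ideal_UNIV: "real_ideal UNIV"
  unfolding real_ideal_def by blast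

lemma real_ideal_INT: "(\<And>U. U \<in> A \<Longrightarrow> real_ideal U) \<Longrightarrow> real_ideal (\<Inter>A)"
  unfolding real_ideal_def by blast

lemma real_ideal_Int: "real_ideal U \<Longrightarrow> real_ideal V \<Longrightarrow> real_ideal (U \<inter> V)"
  using real_ideal_INT[of "{U, V}"] by auto

definition real_ideal_hull :: "(rat \<times> rat) set \<Rightarrow> (rat \<times> rat) set" where
  "real_ideal_hull X = \<Inter>{U. real_ideal U \<and> X \<subseteq> U}"

lemma real_ideal_hull: "real_ideal (real_ideal_hull X)"
  unfolding real_ideal_hull_def by (rule real_ideal_INT) auto

lemma hull_subset: "X \<subseteq> real_ideal_hull X"
  unfolding real_ideal_hull_def by auto

lemma hull_least: "X \<subseteq> U \<Longrightarrow> real_ideal U \<Longrightarrow> real_ideal_hull X \<subseteq> U"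
  unfolding real_ideal_hull_def by auto

lemma real_ideal_imp:
  assumes V: "real_ideal V" and W: "real_ideal W"
  shows "real_ideal {(p, q). \<forall>a b. (a, b) \<in> V \<longrightarrow> (max p a, min q b) \<in> W}" (is "real_ideal ?X")
  unfolding real_ideal_def
proof (intro conjI allI impI)
  fix p q r s assume "(p, q) \<in> ?X" "p \<le> r" "s \<le> q"
  moreover have "max p a \<le> max r a" "min s b \<le> min q b" for a b
    using \<open>p \<le> r\<close> \<open>s \<le> q\<close> by (auto simp: max_def min_def)
  ultimately show "(r, s) \<in> ?X"
    using real_ideal_down[OF W] by blast
next
  fix p q r s :: rat
  assume le: "p \<le> r" "r < q" "q \<le> s" and mem: "(p, q) \<in> ?X" "(r, s) \<in> ?X"
  have "(max p a, min s b) \<in> W" if ab: "(a, b) \<in> V" for a b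
  proof -
    have pq: "(max p a, min q b) \<in> W" and rs: "(max r a, min s b) \<in> W"
      using mem ab by auto
    consider "q \<le> a" | "b \<le> r" | "a < q" "r < b" "a < b" | "b \<le> a" by linarith
    then show ?thesis
    proof cases
      case 1
      then show ?thesis using rs le by (simp add: max_def split: if_splits)
    next
      case 2
      then show ?thesis using pq le by (simp add: min_def split: if_splits)
    next
      case 3
      show ?thesis
        by (rule real_ideal_glue[OF W pq rs]) (use 3 le in auto)
    next
      case 4
      then show ?thesis by (intro real_ideal_empty_interval[OF W]) auto
    qed
  qed
  then show "(p, s) \<in> ?X" by auto
next
  fix p q :: rat
  assume inner: "\<forall>r s. p < r \<longrightarrow> r < s \<longrightarrow> s < q \<longrightarrow> (r, s) \<in> ?X"
  have "(max p a, min q b) \<in> W" if ab: "(a, b) \<in> V" for a b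
  proof (rule real_ideal_inner[OF W])
    fix r s assume rs: "max p a < r" "r < s" "s < min q b"
    then have "(r, s) \<in> ?X" using inner by auto
    with ab have "(max r a, min s b) \<in> W" by auto
    moreover have "max r a = r" "min s b = s" using rs by auto
    ultimately show "(r, s) \<in> W" by simp
  qed
  then show "(p, q) \<in> ?X" by auto
qed

typedef reals_frame = "{U. real_ideal U}"
  morphisms pairs Abs_reals_frame
  using real_ideal_UNIV by auto

setup_lifting type_definition_reals_frame

instantiation reals_frame :: frame
begin

lift_definition less_eq_reals_frame :: "reals_frame \<Rightarrow> reals_frame \<Rightarrow> bool" is "(\<subseteq>)" .
lift_definition less_reals_frame :: "reals_frame \<Rightarrow> reals_frame \<Rightarrow> bool" is "(\<subset>)" .
lift_definition inf_reals_frame :: "reals_frame \<Rightarrow> reals_frame \<Rightarrow> reals_frame" is "(\<inter>)"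
  by (rule real_ideal_Int)
lift_definition sup_reals_frame :: "reals_frame \<Rightarrow> reals_frame \<Rightarrow> reals_frame"
  is "\<lambda>U V. real_ideal_hull (U \<union> V)"
  by (rule real_ideal_hull)
lift_definition Inf_reals_frame :: "reals_frame set \<Rightarrow> reals_frame" is "\<lambda>A. \<Inter>A"
  by (rule real_ideal_INT)
lift_definition Sup_reals_frame :: "reals_frame set \<Rightarrow> reals_frame" is "\<lambda>A. real_ideal_hull (\<Union>A)"
  by (rule real_ideal_hull)
lift_definition top_reals_frame :: reals_frame is UNIV
  by (rule real_ideal_UNIV)
lift_definition bot_reals_frame :: reals_frame is "real_ideal_hull {}"
  by (rule real_ideal_hull)

instance
proof
  fix x y z :: reals_frame and A :: "reals_frame set"
  show "(x < y) = (x \<le> y \<and> \<not> y \<le> x)" by transfer auto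
  show "x \<le> x" by transfer auto
  show "x \<le> y \<Longrightarrow> y \<le> z \<Longrightarrow> x \<le> z" by transfer auto
  show "x \<le> y \<Longrightarrow> y \<le> x \<Longrightarrow> x = y" by transfer auto
  show "inf x y \<le> x" by transfer auto
  show "inf x y \<le> y" by transfer auto
  show "x \<le> y \<Longrightarrow> x \<le> z \<Longrightarrow> x \<le> inf y z" by transfer auto
  show "x \<le> sup x y" by transfer (use hull_subset in blast)
  show "y \<le> sup x y" by transfer (use hull_subset in blast)
  show "y \<le> x \<Longrightarrow> z \<le> x \<Longrightarrow> sup y z \<le> x" by transfer (simp add: hull_least)
  show "x \<in> A \<Longrightarrow> Inf A \<le> x" by transfer auto
  show "(\<And>x. x \<in> A \<Longrightarrow> z \<le> x) \<Longrightarrow> z \<le> Inf A" by transfer auto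
  show "x \<in> A \<Longrightarrow> x \<le> Sup A" by transfer (use hull_subset in blast)
  show "(\<And>x. x \<in> A \<Longrightarrow> x \<le> z) \<Longrightarrow> Sup A \<le> z" by transfer (simp add: hull_least Sup_le_iff)
  show "Inf {} = (top :: reals_frame)" by transfer auto
  show "Sup {} = (bot :: reals_frame)" by transfer auto
  show "inf x (Sup A) = Sup (inf x ` A)"
  proof transfer
    fix V :: "(rat \<times> rat) set" and B :: "(rat \<times> rat) set set"
    assume V: "real_ideal V" and B: "\<forall>U\<in>B. real_ideal U"
    let ?W = "real_ideal_hull (\<Union>((\<inter>) V ` B))"
    let ?X = "{(p, q). \<forall>a b. (a, b) \<in> V \<longrightarrow> (max p a, min q b) \<in> ?W}"
    have B': "real_ideal U" if "U \<in> B" for U using B that by (auto simp: Ball_def)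
    have "U \<subseteq> ?X" if U: "U \<in> B" for U
    proof clarify
      fix p q a b assume "(p, q) \<in> U" "(a, b) \<in> V"
      then have "(max p a, min q b) \<in> V \<inter> U"
        using real_ideal_down[OF V] real_ideal_down[OF B'[OF U]] by auto
      then show "(max p a, min q b) \<in> ?W"
        using hull_subset[of "\<Union>((\<inter>) V ` B)"] U by blast
    qed
    then have "real_ideal_hull (\<Union>B) \<subseteq> ?X"
      by (intro hull_least real_ideal_imp V real_ideal_hull) auto
    then have "V \<inter> real_ideal_hull (\<Union>B) \<subseteq> ?W" by fastforce
    moreover have "?W \<subseteq> V \<inter> real_ideal_hull (\<Union>B)"
      using hull_subset[of "\<Union>B"]
      by (intro hull_least real_ideal_Int V real_ideal_hull) blast+
    ultimately show "V \<inter> real_ideal_hull (\<Union>B) = ?W" by blast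
  qed
qed

end

text \<open>The generator \<open>(p, q)\<close>. The pairs \<open>(r, s)\<close> with \<open>s \<le> r\<close> stand for \<open>\<bottom>\<close>, by the third relation,
  and hence lie below everything.\<close>

lift_definition gen :: "rat \<Rightarrow> rat \<Rightarrow> reals_frame"
  is "\<lambda>p q. {(r, s). s \<le> r \<or> (p \<le> r \<and> s \<le> q)}"
proof -
  fix p q :: rat
  let ?G = "{(r, s). s \<le> r \<or> (p \<le> r \<and> s \<le> q)}"
  have "(a, b) \<in> ?G" if inner: "\<And>r s. a < r \<Longrightarrow> r < s \<Longrightarrow> s < b \<Longrightarrow> (r, s) \<in> ?G" for a b
  proof (cases "a < b")
    case True
    have "p \<le> r" if "a < r" "r < b" for r
      using inner[of r] dense[OF that(2)] that by force
    then have "p \<le> a" using dense_ge_bounded[OF True] by blast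
    have "s \<le> q" if "a < s" "s < b" for s
      using inner[of _ s] dense[OF that(1)] that by force
    then have "b \<le> q" using dense_le_bounded[OF True] by blast
    with \<open>p \<le> a\<close> show ?thesis by auto
  qed auto
  then show "real_ideal ?G" unfolding real_ideal_def by fastforce
qed

lemma gen_le_iff: "gen p q \<le> U \<longleftrightarrow> (p, q) \<in> pairs U"
  by transfer (auto intro: real_ideal_empty_interval elim: real_ideal_down)

lemma le_iff_gen: "U \<le> V \<longleftrightarrow> (\<forall>p q. gen p q \<le> U \<longrightarrow> gen p q \<le> V)"
  unfolding gen_le_iff by transfer auto

lemma eq_Sup_gen: "U = Sup {gen p q | p q. (p, q) \<in> pairs U}"
proof (rule antisym)
  show "U \<le> Sup {gen p q | p q. (p, q) \<in> pairs U}"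
    unfolding le_iff_gen[of U] by (auto simp: gen_le_iff[of _ _ U] intro!: Sup_upper)
  show "Sup {gen p q | p q. (p, q) \<in> pairs U} \<le> U"
    by (auto simp: gen_le_iff intro!: Sup_least)
qed

lemma real_ideal_pairs: "real_ideal (pairs U)"
  using pairs by auto

lemma gen_mono: "p \<le> r \<Longrightarrow> s \<le> q \<Longrightarrow> gen r s \<le> gen p q"
  by transfer auto

theorem real_relations_gen: "real_relations gen"
  unfolding real_relations_def
proof (intro conjI allI impI)
  show "inf (gen p q) (gen r s) = gen (max p r) (min q s)" for p q r s
    by transfer auto
  show "sup (gen p q) (gen r s) = gen p s" if "p \<le> r \<and> r < q \<and> q \<le> s" for p q r s
  proof (rule antisym)
    show "sup (gen p q) (gen r s) \<le> gen p s" using that by (auto intro: gen_mono)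
    have "gen p q \<le> sup (gen p q) (gen r s)" "gen r s \<le> sup (gen p q) (gen r s)" by auto
    then show "gen p s \<le> sup (gen p q) (gen r s)"
      unfolding gen_le_iff using that by (blast intro: real_ideal_glue[OF real_ideal_pairs])
  qed
  show "gen p q = Sup {gen r s | r s. p < r \<and> r < s \<and> s < q}" (is "_ = Sup ?A") for p q
  proof (rule antisym)
    have "gen r s \<le> Sup ?A" if "p < r" "r < s" "s < q" for r s
      using that by (intro Sup_upper) auto
    then show "gen p q \<le> Sup ?A"
      unfolding gen_le_iff by (rule real_ideal_inner[OF real_ideal_pairs])
    show "Sup ?A \<le> gen p q" by (intro Sup_least) (auto intro: gen_mono)
  qed
  have "gen p q \<le> Sup {gen p q | p q. True}" for p q by (rule Sup_upper) auto
  then have "top \<le> Sup {gen p q | p q. True}"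
    unfolding le_iff_gen[of top] by (intro allI impI)
  then show "top = Sup {gen p q | p q. True}" by (rule antisym) (rule top_greatest)
qed

text \<open>For a family \<open>f\<close> satisfying \<open>real_relations\<close>, the frame homomorphism with \<open>gen p q \<mapsto> f p q\<close>.\<close>

definition hom_of :: "(rat \<Rightarrow> rat \<Rightarrow> 'a::frame) \<Rightarrow> reals_frame \<Rightarrow> 'a" where
  "hom_of f U = Sup {f p q | p q. gen p q \<le> U}"

lemma hom_of_le_iff:
  assumes f: "real_relations f"
  shows "hom_of f U \<le> a \<longleftrightarrow> U \<le> Abs_reals_frame {(p, q). f p q \<le> a}"
    and "gen p q \<le> Abs_reals_frame {(p, q). f p q \<le> a} \<longleftrightarrow> f p q \<le> a"
proof -
  have R1: "\<And>p q r s. inf (f p q) (f r s) = f (max p r) (min q s)"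
    and R2: "\<And>p q r s. p \<le> r \<Longrightarrow> r < q \<Longrightarrow> q \<le> s \<Longrightarrow> sup (f p q) (f r s) = f p s"
    and R3: "\<And>p q. f p q = Sup {f r s | r s. p < r \<and> r < s \<and> s < q}"
    using f unfolding real_relations_def by blast+
  have mono: "f r s \<le> f p q" if "p \<le> r" "s \<le> q" for p q r s
    using R1[of p q r s] that by (simp add: max_absorb2 min_absorb2 inf.absorb_iff2)
  have "real_ideal {(p, q). f p q \<le> a}"
    unfolding real_ideal_def
  proof (intro conjI allI impI)
    fix p q r s assume "(p, q) \<in> {(p, q). f p q \<le> a}" "p \<le> r" "s \<le> q"
    then show "(r, s) \<in> {(p, q). f p q \<le> a}" using mono[of p r s q] by auto
  next
    fix p q r s assume "p \<le> r" "r < q" "q \<le> s"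
      "(p, q) \<in> {(p, q). f p q \<le> a}" "(r, s) \<in> {(p, q). f p q \<le> a}"
    then have "f p s = sup (f p q) (f r s)" "f p q \<le> a" "f r s \<le> a"
      using R2[of p r q s] by auto
    then show "(p, s) \<in> {(p, q). f p q \<le> a}" by simp
  next
    fix p q assume "\<forall>r s. p < r \<longrightarrow> r < s \<longrightarrow> s < q \<longrightarrow> (r, s) \<in> {(p, q). f p q \<le> a}"
    then have "Sup {f r s | r s. p < r \<and> r < s \<and> s < q} \<le> a" by (intro Sup_least) auto
    then have "f p q \<le> a" using R3[of p q] by simp
    then show "(p, q) \<in> {(p, q). f p q \<le> a}" by auto
  qed
  then have "pairs (Abs_reals_frame {(p, q). f p q \<le> a}) = {(p, q). f p q \<le> a}"
    by (simp add: Abs_reals_frame_inverse)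
  then show *: "gen p q \<le> Abs_reals_frame {(p, q). f p q \<le> a} \<longleftrightarrow> f p q \<le> a" for p q
    by (simp add: gen_le_iff)
  show "hom_of f U \<le> a \<longleftrightarrow> U \<le> Abs_reals_frame {(p, q). f p q \<le> a}"
    unfolding le_iff_gen[of U] * by (auto simp: hom_of_def Sup_le_iff)
qed

lemma frame_hom_hom_of:
  assumes f: "real_relations f"
  shows "frame_hom (hom_of f)" and "hom_of f (gen p q) = f p q"
proof -
  have R1: "\<And>p q r s. inf (f p q) (f r s) = f (max p r) (min q s)"
    and R4: "top = Sup {f p q | p q. True}"
    using f unfolding real_relations_def by blast+
  have mono: "hom_of f U \<le> hom_of f V" if "U \<le> V" for U V
    unfolding hom_of_def using that by (intro Sup_subset_mono) (auto intro: order_trans)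
  have top: "hom_of f top = top"
    by (simp add: hom_of_def R4)
  have inf: "hom_of f (inf U V) = inf (hom_of f U) (hom_of f V)" for U V
  proof (rule antisym)
    show "hom_of f (inf U V) \<le> inf (hom_of f U) (hom_of f V)" by (simp add: mono)
    have "inf (f p q) (f r s) \<le> hom_of f (inf U V)" if "gen p q \<le> U" "gen r s \<le> V" for p q r s
    proof -
      have "gen (max p r) (min q s) \<le> inf U V"
        using order_trans[OF gen_mono \<open>gen p q \<le> U\<close>] order_trans[OF gen_mono \<open>gen r s \<le> V\<close>] by simp
      then show ?thesis unfolding R1 hom_of_def[of f "inf U V"] by (auto intro: Sup_upper)
    qed
    then have "inf (f p q) (hom_of f V) \<le> hom_of f (inf U V)" if "gen p q \<le> U" for p q
      unfolding hom_of_def[of f V] inf_Sup_frame using that by (auto intro!: Sup_least)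
    then show "inf (hom_of f U) (hom_of f V) \<le> hom_of f (inf U V)"
      unfolding hom_of_def[of f U] inf_commute[of "Sup _"] inf_Sup_frame
      by (auto intro!: Sup_least simp: inf_commute)
  qed
  have Sup: "hom_of f (Sup A) = Sup (hom_of f ` A)" for A
  proof (rule antisym)
    have "U \<le> Abs_reals_frame {(p, q). f p q \<le> Sup (hom_of f ` A)}" if "U \<in> A" for U
      using that by (auto simp: hom_of_le_iff(1)[OF f, symmetric] intro: Sup_upper)
    then show "hom_of f (Sup A) \<le> Sup (hom_of f ` A)"
      unfolding hom_of_le_iff(1)[OF f] by (rule Sup_least)
    show "Sup (hom_of f ` A) \<le> hom_of f (Sup A)"
      by (auto intro!: Sup_least mono Sup_upper)
  qed
  show "frame_hom (hom_of f)" unfolding frame_hom_def using top inf Sup by blast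
  show "hom_of f (gen p q) = f p q"
  proof (rule antisym)
    show "hom_of f (gen p q) \<le> f p q" by (simp add: hom_of_le_iff[OF f])
    show "f p q \<le> hom_of f (gen p q)" unfolding hom_of_def by (auto intro: Sup_upper)
  qed
qed

lemma frame_hom_eq_on_gen:
  assumes "frame_hom g" "frame_hom h" "\<And>p q. g (gen p q) = h (gen p q)"
  shows "g = h"
proof
  fix U
  let ?S = "{gen p q | p q. (p, q) \<in> pairs U}"
  have "g ` ?S = h ` ?S"
    using assms(3) by (intro image_cong) auto
  then have "g (Sup ?S) = h (Sup ?S)"
    using assms(1,2) unfolding frame_hom_def by simp
  then show "g U = h U"
    by (simp flip: eq_Sup_gen)
qed

theorem universal_property:
  fixes f :: "rat \<Rightarrow> rat \<Rightarrow> 'a::frame"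
  assumes "real_relations f"
  shows "\<exists>!h. frame_hom h \<and> (\<forall>p q. h (gen p q) = f p q)"
  by (rule ex1I[of _ "hom_of f"])
    (use frame_hom_hom_of[OF assms] in \<open>auto intro: frame_hom_eq_on_gen\<close>)

text \<open>The elements \<open>(p,-)\<close> and \<open>(-,q)\<close>.\<close>

definition upper_ray :: "rat \<Rightarrow> reals_frame" where
  "upper_ray p = Sup {gen r s | r s. r > p \<and> s > p}"

definition lower_ray :: "rat \<Rightarrow> reals_frame" where
  "lower_ray q = Sup {gen r s | r s. r < q \<and> s < q}"


section \<open>Real-valued continuous functions on a frame\<close>

definition real_functions :: "(reals_frame \<Rightarrow> 'a::frame) set" where
  "real_functions = {\<alpha>. frame_hom \<alpha>}"

definition rat_interval :: "rat \<Rightarrow> rat \<Rightarrow> real set" where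
  "rat_interval p q = {t. of_rat p < t \<and> t < of_rat q}"

text \<open>The operation on \<open>real_functions\<close> induced by a binary operation on the reals, to be used
  with \<open>+\<close>, \<open>*\<close>, \<open>min\<close>, \<open>max\<close>. For these operations, as for \<open>const_fun\<close>, the family passed to
  \<open>hom_of\<close> satisfies \<open>real_relations\<close> when \<open>\<alpha>\<close> and \<open>\<beta>\<close> are in \<open>real_functions\<close>.\<close>

definition lift_op ::
  "(real \<Rightarrow> real \<Rightarrow> real) \<Rightarrow> (reals_frame \<Rightarrow> 'a::frame) \<Rightarrow> (reals_frame \<Rightarrow> 'a) \<Rightarrow> reals_frame \<Rightarrow> 'a" where
  "lift_op opr \<alpha> \<beta> = hom_of (\<lambda>p q.
     Sup {inf (\<alpha> (gen r s)) (\<beta> (gen u v)) | r s u v.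
       {opr x y | x y. x \<in> rat_interval r s \<and> y \<in> rat_interval u v} \<subseteq> rat_interval p q})"

definition const_fun :: "real \<Rightarrow> reals_frame \<Rightarrow> 'a::frame" where
  "const_fun r = hom_of (\<lambda>p q. if r \<in> rat_interval p q then top else bot)"

definition add_fun ::
  "(reals_frame \<Rightarrow> 'a::frame) \<Rightarrow> (reals_frame \<Rightarrow> 'a) \<Rightarrow> reals_frame \<Rightarrow> 'a" where
  "add_fun = lift_op (+)"

text \<open>The additive inverse in the ring \<open>real_functions\<close>.\<close>

definition neg_fun :: "(reals_frame \<Rightarrow> 'a::frame) \<Rightarrow> reals_frame \<Rightarrow> 'a" where
  "neg_fun \<beta> = (THE \<gamma>. \<gamma> \<in> real_functions \<and> add_fun \<beta> \<gamma> = const_fun 0)"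

definition diff_fun ::
  "(reals_frame \<Rightarrow> 'a::frame) \<Rightarrow> (reals_frame \<Rightarrow> 'a) \<Rightarrow> reals_frame \<Rightarrow> 'a" where
  "diff_fun \<alpha> \<beta> = add_fun \<alpha> (neg_fun \<beta>)"

definition coz :: "(reals_frame \<Rightarrow> 'a::frame) \<Rightarrow> 'a" where
  "coz \<alpha> = sup (\<alpha> (lower_ray 0)) (\<alpha> (upper_ray 0))"

definition R_set :: "(reals_frame \<Rightarrow> 'a::frame) \<Rightarrow> real set" where
  "R_set \<alpha> = {r. coz (diff_fun \<alpha> (const_fun r)) \<noteq> top}"

definition C_c :: "(reals_frame \<Rightarrow> 'a::frame) set" where
  "C_c = {\<alpha> \<in> real_functions. countable (R_set \<alpha>)}"

definition completely_regular :: "'a::frame itself \<Rightarrow> bool" where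
  "completely_regular _ \<longleftrightarrow> (\<forall>a::'a. \<exists>S \<subseteq> coz ` real_functions. a = Sup S)"

text \<open>\<open>Coz_c[L]\<close> with the order inherited from \<open>L\<close>.\<close>

definition Coz_c :: "'a::frame gorder" where
  "Coz_c = \<lparr>carrier = coz ` C_c, eq = (=), le = (\<le>)\<rparr>"


section \<open>Sigma-frames, normality and perfect normality\<close>

definition sigma_frame :: "'a gorder \<Rightarrow> bool" where
  "sigma_frame M \<longleftrightarrow> lattice M \<and>
     (\<forall>a\<in>carrier M. \<forall>b\<in>carrier M. \<forall>c\<in>carrier M.
        a \<sqinter>\<^bsub>M\<^esub> (b \<squnion>\<^bsub>M\<^esub> c) = (a \<sqinter>\<^bsub>M\<^esub> b) \<squnion>\<^bsub>M\<^esub> (a \<sqinter>\<^bsub>M\<^esub> c)) \<and>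
     (\<forall>S. S \<subseteq> carrier M \<longrightarrow> countable S \<longrightarrow> (\<exists>s. least M s (Upper M S))) \<and>
     (\<forall>a\<in>carrier M. \<forall>S. S \<subseteq> carrier M \<longrightarrow> countable S \<longrightarrow>
        a \<sqinter>\<^bsub>M\<^esub> (\<Squnion>\<^bsub>M\<^esub>S) = \<Squnion>\<^bsub>M\<^esub>((\<lambda>s. a \<sqinter>\<^bsub>M\<^esub> s) ` S))"

definition normal_lattice :: "'a gorder \<Rightarrow> bool" where
  "normal_lattice M \<longleftrightarrow> bounded_lattice M \<and>
     (\<forall>a\<in>carrier M. \<forall>b\<in>carrier M. a \<squnion>\<^bsub>M\<^esub> b = \<top>\<^bsub>M\<^esub> \<longrightarrow>
        (\<exists>u\<in>carrier M. \<exists>v\<in>carrier M.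
           a \<squnion>\<^bsub>M\<^esub> u = \<top>\<^bsub>M\<^esub> \<and> v \<squnion>\<^bsub>M\<^esub> b = \<top>\<^bsub>M\<^esub> \<and> u \<sqinter>\<^bsub>M\<^esub> v = \<bottom>\<^bsub>M\<^esub>))"

definition perfectly_normal :: "'a gorder \<Rightarrow> bool" where
  "perfectly_normal M \<longleftrightarrow> sigma_frame M \<and> normal_lattice M \<and>
     (\<forall>a\<in>carrier M. \<exists>x :: nat \<Rightarrow> 'a. (\<forall>n. x n \<in> carrier M) \<and>
        (\<forall>b\<in>carrier M. \<forall>c\<in>carrier M.
           a \<sqinter>\<^bsub>M\<^esub> b = a \<sqinter>\<^bsub>M\<^esub> c \<longleftrightarrow> (\<forall>n. x n \<squnion>\<^bsub>M\<^esub> b = x n \<squnion>\<^bsub>M\<^esub> c)))"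

end

theory Submission
  imports Defs "HOL-Analysis.Continuum_Not_Denumerable"
begin

text \<open>The elements of \<open>Coz_c[L]\<close> are exactly the countable joins of complemented elements of \<open>L\<close>. Indeed
  if \<open>r \<notin> R_\<alpha>\<close> then \<open>\<alpha>(r,-)\<close> and \<open>\<alpha>(-,r)\<close> are complements of each other; as \<open>R_\<alpha>\<close> is countable, there are
  such \<open>r\<close> arbitrarily close to \<open>0\<close> on both sides. Conversely a countable join of complemented elements
  is the cozero element of a function with values in \<open>{0} \<union> {1/n | n \<ge> 1}\<close>. Closure under
  countable joins and finite meets, normality and perfect normality are then lattice computations
  with complements. In particular no ring operation on \<open>C_c(L)\<close> is needed, only the translations \<open>\<alpha> - r\<close>.\<close>

text \<open>The frame law at a two-element set distributes \<open>inf\<close> over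
  \<open>sup\<close>; expanding \<open>inf (sup x y) (sup x z)\<close> with it and absorbing gives
  the dual law that the class asks for.\<close>

instance frame \<subseteq> distrib_lattice
proof
  have inf_sup: "inf x (sup y z) = sup (inf x y) (inf x z)" for x y z :: 'a
    using inf_Sup_frame[of x "{y, z}"] by simp
  have "inf (sup x y) (sup x z) = sup (inf (sup x y) x) (inf (sup x y) z)" for x y z :: 'a
    by (rule inf_sup)
  moreover have "inf (sup x y) x = x" for x y :: 'a
    by (metis inf.commute inf_sup_absorb)
  moreover have "inf (sup x y) z = sup (inf x z) (inf y z)" for x y z :: 'a
    by (metis inf.commute inf_sup)
  moreover have "sup x (inf x z) = x" for x z :: 'a
    by (rule sup_inf_absorb)
  ultimately show "sup x (inf y z) = inf (sup x y) (sup x z)" for x y z :: 'a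
    by (simp flip: sup.assoc)
qed

section \<open>Elements of the frame of reals as open sets\<close>

text \<open>\<open>pts\<close> and \<open>of_open\<close> will be mutually inverse order
  isomorphisms between the frame of reals and the open subsets of the line, so that computations
  with generators become computations with sets.\<close>

definition pts :: "reals_frame \<Rightarrow> real set" where
  "pts U = (\<Union>(p, q)\<in>pairs U. rat_interval p q)"

definition of_open :: "real set \<Rightarrow> reals_frame" where
  "of_open A = Abs_reals_frame {(p, q). rat_interval p q \<subseteq> A}"

lemma open_rat_interval: "open (rat_interval p q)"
proof -
  have "rat_interval p q = {of_rat p<..<of_rat q}" by (auto simp: rat_interval_def)
  then show ?thesis by simp
qed

lemma open_pts: "open (pts U)"
  unfolding pts_def by (auto intro!: open_UN open_rat_interval)

lemma ex_rat_interval: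
  assumes "open A" "x \<in> A"
  obtains p q where "x \<in> rat_interval p q" "rat_interval p q \<subseteq> A"
proof -
  obtain e where e: "e > 0" "\<And>y. dist y x < e \<Longrightarrow> y \<in> A"
    using assms unfolding open_dist by blast
  obtain p where p: "x - e < of_rat p" "of_rat p < x"
    using of_rat_dense[of "x - e" x] e(1) by auto
  obtain q where q: "x < of_rat q" "of_rat q < x + e"
    using of_rat_dense[of x "x + e"] e(1) by auto
  show thesis
    by (rule that[of p q]) (use p q e(2) in \<open>auto simp: rat_interval_def dist_real_def\<close>)
qed

text \<open>If the right side fails, density gives a rational point in the first interval but not in
  the second. The right side is also the condition defining \<open>gen p q\<close>, which is how
  \<open>pts_gen\<close> follows.\<close>

lemma rat_interval_subset_iff:
  "rat_interval r s \<subseteq> rat_interval p q \<longleftrightarrow> s \<le> r \<or> (p \<le> r \<and> s \<le> q)"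
proof
  assume sub: "rat_interval r s \<subseteq> rat_interval p q"
  show "s \<le> r \<or> (p \<le> r \<and> s \<le> q)"
  proof (rule ccontr)
    assume "\<not> ?thesis"
    then have "r < s" and "r < p \<or> q < s" by auto
    from this(2) show False
    proof
      assume "r < p"
      then obtain t where "r < t" "t < min p s" using dense[of r "min p s"] \<open>r < s\<close> by auto
      then have "of_rat t \<in> rat_interval r s" "of_rat t \<notin> rat_interval p q"
        by (auto simp: rat_interval_def of_rat_less)
      with sub show False by blast
    next
      assume "q < s"
      then obtain t where "max q r < t" "t < s" using dense[of "max q r" s] \<open>r < s\<close> by auto
      then have "of_rat t \<in> rat_interval r s" "of_rat t \<notin> rat_interval p q"
        by (auto simp: rat_interval_def of_rat_less)
      with sub show False by blast
    qed
  qed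
next
  assume "s \<le> r \<or> (p \<le> r \<and> s \<le> q)"
  then have "(of_rat s :: real) \<le> of_rat r \<or> (of_rat p :: real) \<le> of_rat r \<and> (of_rat s :: real) \<le> of_rat q"
    by (simp add: of_rat_less_eq)
  then show "rat_interval r s \<subseteq> rat_interval p q"
    by (auto simp: rat_interval_def)
qed

lemma real_ideal_subset: "real_ideal {(p, q). rat_interval p q \<subseteq> A}"
  unfolding real_ideal_def
proof (intro conjI allI impI)
  fix p q r s
  assume "(p, q) \<in> {(p, q). rat_interval p q \<subseteq> A}" "p \<le> r" "s \<le> q"
  then show "(r, s) \<in> {(p, q). rat_interval p q \<subseteq> A}"
    using rat_interval_subset_iff[of r s p q] by auto
next
  fix p q r s :: rat
  assume "p \<le> r" "r < q" "q \<le> s" and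
    sub: "(p, q) \<in> {(p, q). rat_interval p q \<subseteq> A}" "(r, s) \<in> {(p, q). rat_interval p q \<subseteq> A}"
  \<comment> \<open>Strictness matters: for \<open>r = q\<close> the point \<open>q\<close> could be
    missing from the union.\<close>
  have "(of_rat r :: real) < of_rat q" using \<open>r < q\<close> by (simp add: of_rat_less)
  then have "rat_interval p s \<subseteq> rat_interval p q \<union> rat_interval r s"
    by (auto simp: rat_interval_def)
  with sub show "(p, s) \<in> {(p, q). rat_interval p q \<subseteq> A}" by auto
next
  fix p q :: rat
  assume inner: "\<forall>r s. p < r \<longrightarrow> r < s \<longrightarrow> s < q \<longrightarrow> (r, s) \<in> {(p, q). rat_interval p q \<subseteq> A}"
  have "x \<in> A" if "x \<in> rat_interval p q" for x
  proof -
    obtain r where r: "of_rat p < (of_rat r :: real)" "of_rat r < x"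
      using of_rat_dense[of "of_rat p" x] \<open>x \<in> rat_interval p q\<close> by (auto simp: rat_interval_def)
    obtain s where s: "x < of_rat s" "of_rat s < (of_rat q :: real)"
      using of_rat_dense[of x "of_rat q"] \<open>x \<in> rat_interval p q\<close> by (auto simp: rat_interval_def)
    have "(of_rat r :: real) < of_rat s" using r s by simp
    with r s have "rat_interval r s \<subseteq> A" using inner by (simp add: of_rat_less)
    with r s show ?thesis by (auto simp: rat_interval_def)
  qed
  then show "(p, q) \<in> {(p, q). rat_interval p q \<subseteq> A}" by auto
qed

lemma pairs_of_open: "pairs (of_open A) = {(p, q). rat_interval p q \<subseteq> A}"
  unfolding of_open_def by (simp add: Abs_reals_frame_inverse real_ideal_subset)

lemma pts_of_open: "open A \<Longrightarrow> pts (of_open A) = A"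
  by (auto simp: pts_def pairs_of_open) (meson ex_rat_interval)

text \<open>Spatiality of the frame of reals, i.e. compactness of closed intervals: bisection shows that
  \<open>[a, b]\<close> sits inside a single pair of the ideal.\<close>

lemma mem_pairs_iff: "(p, q) \<in> pairs U \<longleftrightarrow> rat_interval p q \<subseteq> pts U"
proof
  show "(p, q) \<in> pairs U \<Longrightarrow> rat_interval p q \<subseteq> pts U"
    unfolding pts_def by blast
next
  assume sub: "rat_interval p q \<subseteq> pts U"
  note U = real_ideal_pairs[of U]
  show "(p, q) \<in> pairs U"
  proof (rule real_ideal_inner[OF U])
    \<comment> \<open>By the third closure condition it is enough to treat
      \<open>p < r < s < q\<close>; the closed interval \<open>[r, s]\<close> then lies in
      \<open>pts U\<close>.\<close>
    fix r s assume rs: "p < r" "r < s" "s < q"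
    \<comment> \<open>\<open>P a b\<close>: a closed subinterval \<open>[a, b]\<close> of
      \<open>[r, s]\<close> lies strictly inside a single pair of the ideal. The strict bounds make
      the pairs of adjacent intervals overlap.\<close>
    define P where "P a b \<longleftrightarrow> of_rat r \<le> a \<and> a \<le> b \<and> b \<le> of_rat s \<longrightarrow>
      (\<exists>u v. of_rat u < a \<and> b < of_rat v \<and> (u, v) \<in> pairs U)" for a b :: real
    have rs': "(of_rat p :: real) < of_rat r" "(of_rat r :: real) < of_rat s" "(of_rat s :: real) < of_rat q"
      using rs by (simp_all add: of_rat_less)
    then have "(of_rat r :: real) \<le> of_rat s" by simp
    then have "P (of_rat r) (of_rat s)"
    proof (induction rule: Bolzano)
      case (trans a b c)
      show ?case
        unfolding P_def
      proof
        assume "of_rat r \<le> a \<and> a \<le> c \<and> c \<le> of_rat s"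
        with trans obtain u v u' v' where
          uv: "of_rat u < a" "b < of_rat v" "(u, v) \<in> pairs U" and
          uv': "of_rat u' < b" "c < of_rat v'" "(u', v') \<in> pairs U"
          unfolding P_def by auto
        have "of_rat u' < (of_rat v :: real)" using uv(2) uv'(1) by simp
        then have "u' < v" by (simp add: of_rat_less)
        \<comment> \<open>Either one of the two pairs already covers \<open>[a, c]\<close>, or they
          overlap properly and the second closure condition glues them.\<close>
        consider "u' \<le> u" | "v' \<le> v" | "u \<le> u'" "v \<le> v'" by linarith
        then show "\<exists>u v. of_rat u < a \<and> c < of_rat v \<and> (u, v) \<in> pairs U"
        proof cases
          case 1
          then have "(of_rat u' :: real) \<le> of_rat u" by (simp add: of_rat_less_eq)
          with uv uv' show ?thesis by (intro exI[of _ u'] exI[of _ v']) auto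
        next
          case 2
          then have "(of_rat v' :: real) \<le> of_rat v" by (simp add: of_rat_less_eq)
          with uv uv' show ?thesis by (intro exI[of _ u] exI[of _ v]) auto
        next
          case 3
          then have "(u, v') \<in> pairs U"
            using real_ideal_glue[OF U uv(3) uv'(3)] \<open>u' < v\<close> by auto
          with uv uv' show ?thesis by blast
        qed
      qed
    next
      case (local x)
      then have "x \<in> rat_interval p q" using rs' by (auto simp: rat_interval_def)
      with sub obtain u v where uv: "(u, v) \<in> pairs U" "of_rat u < x" "x < of_rat v"
        unfolding pts_def rat_interval_def by blast
      \<comment> \<open>An interval around \<open>x\<close> that is shorter than the distance from
        \<open>x\<close> to either end point stays inside \<open>(u, v)\<close>.\<close>
      show ?case
      proof (intro exI[of _ "min (x - of_rat u) (of_rat v - x)"] conjI allI impI)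
        show "0 < min (x - of_rat u) (of_rat v - x)" using uv by simp
        show "P a b" if "a \<le> x \<and> x \<le> b \<and> b - a < min (x - of_rat u) (of_rat v - x)" for a b
          unfolding P_def using uv(1) that by (intro impI exI[of _ u] exI[of _ v]) auto
      qed
    qed
    then obtain u v where "of_rat u < (of_rat r :: real)" "of_rat s < (of_rat v :: real)" "(u, v) \<in> pairs U"
      unfolding P_def using rs' by auto
    then show "(r, s) \<in> pairs U"
      using real_ideal_down[OF U] by (simp add: of_rat_less)
  qed
qed

lemma pts_subset_iff: "pts U \<subseteq> pts V \<longleftrightarrow> U \<le> V"
proof
  show "pts U \<subseteq> pts V" if "U \<le> V"
    using that by (auto simp: pts_def less_eq_reals_frame.rep_eq)
  show "U \<le> V" if "pts U \<subseteq> pts V"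
    using that by (auto simp: less_eq_reals_frame.rep_eq mem_pairs_iff)
qed

lemma of_open_pts: "of_open (pts U) = U"
  by (metis antisym open_pts order_refl pts_of_open pts_subset_iff)

lemma pts_inf: "pts (inf U V) = pts U \<inter> pts V"
proof -
  have "x \<in> pts (inf U V)" if x: "x \<in> pts U \<inter> pts V" for x
  proof -
    obtain p q where "x \<in> rat_interval p q" "rat_interval p q \<subseteq> pts U \<inter> pts V"
      using ex_rat_interval[OF open_Int[OF open_pts open_pts] x] by metis
    then show ?thesis
      by (auto simp: pts_def[of "inf U V"] inf_reals_frame.rep_eq mem_pairs_iff)
  qed
  moreover have "pts (inf U V) \<subseteq> pts U \<inter> pts V"
    using pts_subset_iff[of "inf U V"] by simp
  ultimately show ?thesis by blast
qed

text \<open>Joins are ideal hulls, so their points cannot be read off from the pairs of the members.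
  Instead, \<open>of_open\<close> of the union is an upper bound of the family and hence bounds the
  join.\<close>

lemma pts_Sup: "pts (Sup \<A>) = (\<Union>U\<in>\<A>. pts U)"
proof (rule antisym)
  let ?O = "\<Union>U\<in>\<A>. pts U"
  have O: "open ?O" by (auto intro: open_pts)
  have "U \<le> of_open ?O" if "U \<in> \<A>" for U
    using that by (auto simp: pts_of_open[OF O] simp flip: pts_subset_iff)
  then have "Sup \<A> \<le> of_open ?O" by (rule Sup_least)
  then show "pts (Sup \<A>) \<subseteq> ?O"
    by (simp add: pts_of_open[OF O] flip: pts_subset_iff)
  show "?O \<subseteq> pts (Sup \<A>)"
    by (intro UN_least) (simp add: pts_subset_iff Sup_upper)
qed

lemma pts_top: "pts top = UNIV"
  by (metis open_UNIV pts_of_open pts_subset_iff top_greatest top.extremum_unique)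

lemma pts_gen: "pts (gen p q) = rat_interval p q"
proof -
  have "gen p q = of_open (rat_interval p q)"
    by (simp add: gen.rep_eq pairs_of_open rat_interval_subset_iff flip: pairs_inject)
  then show ?thesis by (simp add: pts_of_open open_rat_interval)
qed

lemma pts_lower_ray: "pts (lower_ray q) = {..<of_rat q}"
proof -
  have "\<exists>r s. r < q \<and> s < q \<and> of_rat r < x \<and> x < of_rat s" if "x < of_rat q" for x :: real
  proof -
    obtain s where s: "x < of_rat s" "of_rat s < (of_rat q :: real)"
      using of_rat_dense[OF \<open>x < of_rat q\<close>] by auto
    obtain r where r: "of_rat r < x" using of_rat_dense[of "x - 1" x] by auto
    have "of_rat r < (of_rat q :: real)" using r that by simp
    with r s show ?thesis by (auto simp: of_rat_less)
  qed
  moreover have "x < of_rat q" if "s < q" "x < of_rat s" for s and x :: real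
    using that by (metis of_rat_less less_trans)
  ultimately show ?thesis
    unfolding lower_ray_def pts_Sup by (fastforce simp: pts_gen rat_interval_def)
qed

lemma pts_upper_ray: "pts (upper_ray p) = {of_rat p<..}"
proof -
  have "\<exists>r s. p < r \<and> p < s \<and> of_rat r < x \<and> x < of_rat s" if "of_rat p < x" for x :: real
  proof -
    obtain r where r: "of_rat p < (of_rat r :: real)" "of_rat r < x"
      using of_rat_dense[OF \<open>of_rat p < x\<close>] by auto
    obtain s where s: "x < of_rat s" using of_rat_dense[of x "x + 1"] by auto
    have "of_rat p < (of_rat s :: real)" using s that by simp
    with r s show ?thesis by (auto simp: of_rat_less)
  qed
  moreover have "of_rat p < x" if "p < r" "of_rat r < x" for r and x :: real
    using that by (metis of_rat_less less_trans)
  ultimately show ?thesis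
    unfolding upper_ray_def pts_Sup by (fastforce simp: pts_gen rat_interval_def)
qed

section \<open>Frame homomorphisms on open sets of reals\<close>

lemma frame_hom_Sup: "frame_hom h \<Longrightarrow> h (Sup S) = Sup (h ` S)"
  by (simp add: frame_hom_def)

lemma frame_hom_inf: "frame_hom h \<Longrightarrow> h (inf x y) = inf (h x) (h y)"
  by (simp add: frame_hom_def)

lemma frame_hom_top: "frame_hom h \<Longrightarrow> h top = top"
  by (simp add: frame_hom_def)

lemma frame_hom_sup: "frame_hom h \<Longrightarrow> h (sup x y) = sup (h x) (h y)"
  using frame_hom_Sup[of h "{x, y}"] by simp

lemma frame_hom_bot: "frame_hom h \<Longrightarrow> h bot = bot"
  using frame_hom_Sup[of h "{}"] by simp

lemma frame_hom_mono: "frame_hom h \<Longrightarrow> x \<le> y \<Longrightarrow> h x \<le> h y"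
  by (metis frame_hom_inf inf.absorb_iff1)

lemma of_open_Int: "open A \<Longrightarrow> open B \<Longrightarrow> of_open (A \<inter> B) = inf (of_open A) (of_open B)"
  by (metis of_open_pts pts_inf pts_of_open)

lemma of_open_Union:
  assumes "\<And>A. A \<in> \<A> \<Longrightarrow> open A"
  shows "of_open (\<Union>\<A>) = Sup (of_open ` \<A>)"
proof -
  have "pts (Sup (of_open ` \<A>)) = \<Union>\<A>"
    using assms by (auto simp: pts_Sup pts_of_open)
  then show ?thesis by (metis of_open_pts)
qed

lemma of_open_Un: "open A \<Longrightarrow> open B \<Longrightarrow> of_open (A \<union> B) = sup (of_open A) (of_open B)"
  using of_open_Union[of "{A, B}"] by auto

lemma of_open_empty: "of_open {} = bot"
  using of_open_Union[of "{}"] by simp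

lemma real_relations_frame_hom:
  assumes "frame_hom h"
  shows "real_relations (\<lambda>p q. h (gen p q))"
proof -
  note R = real_relations_gen[unfolded real_relations_def]
  have R3: "gen p q = Sup {gen r s | r s. p < r \<and> r < s \<and> s < q}" for p q using R by blast
  have R4: "top = Sup {gen p q | p q. True}" using R by blast
  have "h (gen p q) = Sup {h (gen r s) | r s. p < r \<and> r < s \<and> s < q}" for p q
    by (subst R3, subst frame_hom_Sup[OF assms], rule arg_cong[of _ _ Sup]) auto
  moreover have "top = Sup {h (gen p q) | p q. True}"
    by (subst frame_hom_top[OF assms, symmetric], subst R4, subst frame_hom_Sup[OF assms],
      rule arg_cong[of _ _ Sup]) auto
  moreover have "inf (h (gen p q)) (h (gen r s)) = h (gen (max p r) (min q s))" for p q r s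
    using R by (metis frame_hom_inf[OF assms])
  moreover have "sup (h (gen p q)) (h (gen r s)) = h (gen p s)" if "p \<le> r \<and> r < q \<and> q \<le> s" for p q r s
    using R that by (metis frame_hom_sup[OF assms])
  ultimately show ?thesis
    unfolding real_relations_def by blast
qed

text \<open>The operations on \<open>real_functions\<close> are defined through
  \<open>hom_of\<close>. To evaluate one, it now suffices to exhibit a homomorphism with the
  prescribed values on generators.\<close>

lemma hom_of_frame_hom:
  assumes "frame_hom h"
  shows "hom_of (\<lambda>p q. h (gen p q)) = h"
  using frame_hom_hom_of[OF real_relations_frame_hom[OF assms]] assms
  by (intro frame_hom_eq_on_gen) auto

section \<open>Translations, constants and additive inverses of constants\<close>

definition shift :: "real \<Rightarrow> reals_frame \<Rightarrow> reals_frame" where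
  "shift s U = of_open ((\<lambda>x. x + s) -` pts U)"

lemma open_shift: "open A \<Longrightarrow> open ((\<lambda>x. x + s) -` A)" for s :: real
  by (intro open_vimage) (auto intro!: continuous_intros)

lemma pts_shift: "pts (shift s U) = (\<lambda>x. x + s) -` pts U"
  by (simp add: shift_def pts_of_open open_shift open_pts)

lemma pts_inject: "pts U = pts V \<longleftrightarrow> U = V"
  by (metis of_open_pts)

lemma frame_hom_shift: "frame_hom (shift s)"
  unfolding frame_hom_def
  by (auto simp: pts_shift pts_top pts_inf pts_Sup simp flip: pts_inject)

lemma shift_shift: "shift s (shift t U) = shift (s + t) U"
  by (auto simp: pts_shift add.assoc simp flip: pts_inject)

lemma shift_0: "shift 0 U = U"
  by (auto simp: pts_shift simp flip: pts_inject)

lemma frame_hom_comp: "frame_hom g \<Longrightarrow> frame_hom h \<Longrightarrow> frame_hom (\<lambda>x. g (h x))"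
  by (simp add: frame_hom_def image_image)

text \<open>Evaluation at the point \<open>r\<close>; it extends the family defining
  \<open>const_fun r\<close> from generators to all elements.\<close>

definition point_hom :: "real \<Rightarrow> reals_frame \<Rightarrow> 'a::frame" where
  "point_hom r U = (if r \<in> pts U then top else bot)"

lemma frame_hom_point_hom: "frame_hom (point_hom r :: reals_frame \<Rightarrow> 'a::frame)"
proof -
  have "point_hom r (Sup S) = Sup (point_hom r ` S :: 'a set)" for S
  proof (cases "\<exists>U\<in>S. r \<in> pts U")
    case True
    then obtain U where "U \<in> S" "r \<in> pts U" by blast
    then have "Sup (point_hom r ` S :: 'a set) = top"
      by (intro top_le) (auto simp: point_hom_def intro!: Sup_upper rev_image_eqI)
    with True show ?thesis by (simp add: point_hom_def pts_Sup)
  next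
    case False
    then have "point_hom r ` S \<subseteq> {bot :: 'a}" by (auto simp: point_hom_def)
    then have "Sup (point_hom r ` S :: 'a set) = bot"
      by (metis Sup_empty ccpo_Sup_singleton subset_singletonD)
    with False show ?thesis by (simp add: point_hom_def pts_Sup)
  qed
  then show ?thesis
    by (auto simp: frame_hom_def point_hom_def pts_top pts_inf)
qed

lemma const_fun_eq: "const_fun r = point_hom r"
proof -
  have "const_fun r = (hom_of (\<lambda>p q. point_hom r (gen p q)) :: reals_frame \<Rightarrow> 'a)"
    unfolding const_fun_def point_hom_def pts_gen ..
  also have "\<dots> = point_hom r"
    by (rule hom_of_frame_hom[OF frame_hom_point_hom])
  finally show ?thesis .
qed

text \<open>The Minkowski sum of two nonempty open intervals is the open interval between the sums
  of the end points. An empty summand would make the inclusion trivially true, hence the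
  assumptions.\<close>

lemma rat_interval_sums_subset_iff:
  assumes "a < b" "u < v"
  shows "{x + y | x y. x \<in> rat_interval a b \<and> y \<in> rat_interval u v} \<subseteq> rat_interval p q
    \<longleftrightarrow> p \<le> a + u \<and> b + v \<le> q" (is "?S \<subseteq> _ \<longleftrightarrow> _")
proof -
  have "?S = rat_interval (a + u) (b + v)"
  proof (intro antisym subsetI)
    fix z assume "z \<in> ?S"
    then show "z \<in> rat_interval (a + u) (b + v)"
      by (auto simp: rat_interval_def of_rat_add)
  next
    fix z assume z: "z \<in> rat_interval (a + u) (b + v)"
    \<comment> \<open>A decomposition \<open>z = x + y\<close> amounts to a point \<open>x\<close>
      common to \<open>(a, b)\<close> and \<open>(z - v, z - u)\<close>; these intervals
      meet.\<close>
    have "max (of_rat a) (z - of_rat v) < (min (of_rat b) (z - of_rat u) :: real)"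
      using z assms by (auto simp: rat_interval_def of_rat_add of_rat_less)
    then obtain x where "max (of_rat a) (z - of_rat v) < x" "x < (min (of_rat b) (z - of_rat u) :: real)"
      using dense by blast
    then have "x \<in> rat_interval a b" "z - x \<in> rat_interval u v" by (auto simp: rat_interval_def)
    moreover have "z = x + (z - x)" by simp
    ultimately show "z \<in> ?S" by blast
  qed
  with assms show ?thesis by (auto simp: rat_interval_subset_iff)
qed

text \<open>A term of the join vanishes unless \<open>s\<close> lies in \<open>(u, v)\<close>, and
  then it is \<open>\<alpha> (gen a b)\<close> with \<open>(a, b) + s\<close> inside
  \<open>(p, q)\<close>. Such intervals cover the preimage of \<open>(p, q)\<close> under
  translation by \<open>s\<close>.\<close>

lemma add_fun_const:
  fixes \<alpha> :: "reals_frame \<Rightarrow> 'a::frame"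
  assumes \<alpha>: "frame_hom \<alpha>"
  shows "add_fun \<alpha> (const_fun s) = (\<lambda>U. \<alpha> (shift s U))"
proof -
  define F where "F p q = {inf (\<alpha> (gen a b)) (point_hom s (gen u v)) | a b u v.
       {x + y | x y. x \<in> rat_interval a b \<and> y \<in> rat_interval u v} \<subseteq> rat_interval p q}" for p q
  have "Sup (F p q) = \<alpha> (shift s (gen p q))" for p q
  proof (rule antisym)
    show "Sup (F p q) \<le> \<alpha> (shift s (gen p q))"
    proof (rule Sup_least)
      fix z assume "z \<in> F p q"
      then obtain a b u v where z: "z = inf (\<alpha> (gen a b)) (point_hom s (gen u v))"
        and sub: "{x + y | x y. x \<in> rat_interval a b \<and> y \<in> rat_interval u v} \<subseteq> rat_interval p q"
        unfolding F_def by blast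
      show "z \<le> \<alpha> (shift s (gen p q))"
      proof (cases "s \<in> rat_interval u v")
        case True
        then have "gen a b \<le> shift s (gen p q)"
          using sub by (auto simp: pts_shift pts_gen simp flip: pts_subset_iff)
        then show ?thesis
          unfolding z using frame_hom_mono[OF \<alpha>] by (meson le_infI1)
      next
        case False
        then show ?thesis by (simp add: z point_hom_def pts_gen)
      qed
    qed
  next
    \<comment> \<open>As \<open>s\<close> may be irrational, the translate of \<open>(p, q)\<close>
      by \<open>- s\<close> need not be a generator; it is covered by generators that leave a
      rational interval \<open>(u, v)\<close> of room around \<open>s\<close>.\<close>
    let ?G = "{gen a b | a b. \<exists>u v. p \<le> a + u \<and> b + v \<le> q \<and> s \<in> rat_interval u v}"
    have "x \<in> pts (Sup ?G)" if x: "x \<in> pts (shift s (gen p q))" for x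
    proof -
      \<comment> \<open>Each of \<open>a\<close>, \<open>b\<close>, \<open>u\<close>,
        \<open>v\<close> will be within \<open>e\<close> of \<open>x\<close> or \<open>s\<close>, so
        \<open>a + u\<close> and \<open>b + v\<close> are less than \<open>2 * e\<close> away from
        \<open>x + s\<close>, while \<open>p\<close> and \<open>q\<close> are at least
        \<open>4 * e\<close> away.\<close>
      define e where "e = min (x + s - of_rat p) (of_rat q - (x + s)) / 4"
      have e: "e > 0" "4 * e \<le> x + s - of_rat p" "4 * e \<le> of_rat q - (x + s)"
        using x by (auto simp: e_def pts_shift pts_gen rat_interval_def)
      obtain a where a: "x - e < of_rat a" "of_rat a < x"
        using of_rat_dense[of "x - e" x] e(1) by auto
      obtain b where b: "x < of_rat b" "of_rat b < x + e"
        using of_rat_dense[of x "x + e"] e(1) by auto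
      obtain u where u: "s - e < of_rat u" "of_rat u < s"
        using of_rat_dense[of "s - e" s] e(1) by auto
      obtain v where v: "s < of_rat v" "of_rat v < s + e"
        using of_rat_dense[of s "s + e"] e(1) by auto
      have "of_rat p \<le> (of_rat (a + u) :: real)" "of_rat (b + v) \<le> (of_rat q :: real)"
        unfolding of_rat_add using e a b u v by linarith+
      then have "gen a b \<in> ?G"
        using u v by (force simp: of_rat_less_eq rat_interval_def)
      with a b show ?thesis
        unfolding pts_Sup by (intro UN_I[of "gen a b"]) (auto simp: pts_gen rat_interval_def)
    qed
    then have "shift s (gen p q) \<le> Sup ?G"
      by (auto simp flip: pts_subset_iff)
    then have "\<alpha> (shift s (gen p q)) \<le> Sup (\<alpha> ` ?G)"
      unfolding frame_hom_Sup[OF \<alpha>, symmetric] by (rule frame_hom_mono[OF \<alpha>])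
    also have "\<dots> \<le> Sup (F p q)"
    proof (rule Sup_least)
      fix z assume "z \<in> \<alpha> ` ?G"
      then obtain a b u v where z: "z = \<alpha> (gen a b)" and uv: "p \<le> a + u" "b + v \<le> q" "s \<in> rat_interval u v"
        by blast
      have "(of_rat u :: real) < of_rat v" using uv by (simp add: rat_interval_def)
      then have "u < v" by (simp add: of_rat_less)
      have "{x + y | x y. x \<in> rat_interval a b \<and> y \<in> rat_interval u v} \<subseteq> rat_interval p q"
      proof (cases "a < b")
        case True
        then show ?thesis using rat_interval_sums_subset_iff[OF True \<open>u < v\<close>] uv by blast
      next
        case False
        \<comment> \<open>\<open>rat_interval 0 0\<close> is empty, so the inclusion criterion at it
          yields emptiness.\<close>
        then have "rat_interval a b = {}"
          using rat_interval_subset_iff[of a b 0 0] by (auto simp: rat_interval_def)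
        then show ?thesis by simp
      qed
      moreover have "z = inf (\<alpha> (gen a b)) (point_hom s (gen u v))"
        using uv by (simp add: z point_hom_def pts_gen)
      ultimately have "z \<in> F p q" unfolding F_def by blast
      then show "z \<le> Sup (F p q)" by (rule Sup_upper)
    qed
    finally show "\<alpha> (shift s (gen p q)) \<le> Sup (F p q)" .
  qed
  then have "add_fun \<alpha> (const_fun s) = hom_of (\<lambda>p q. \<alpha> (shift s (gen p q)))"
    unfolding add_fun_def lift_op_def const_fun_eq F_def by presburger
  also have "\<dots> = (\<lambda>U. \<alpha> (shift s U))"
    by (rule hom_of_frame_hom[OF frame_hom_comp[OF \<alpha> frame_hom_shift]])
  finally show ?thesis .
qed

text \<open>Exchanging the two intervals permutes the terms; the inclusion is proved for arbitrary
  \<open>\<alpha>\<close> and \<open>\<beta>\<close>, so it serves in both directions. Commutativity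
  makes \<open>add_fun_const\<close> applicable to a constant on the left, as in
  \<open>neg_fun\<close>.\<close>

lemma add_fun_commute: "add_fun \<alpha> \<beta> = add_fun \<beta> \<alpha>"
proof -
  have "{inf (\<alpha> (gen r s)) (\<beta> (gen u v)) | r s u v.
       {x + y | x y. x \<in> rat_interval r s \<and> y \<in> rat_interval u v} \<subseteq> rat_interval p q} \<subseteq>
    {inf (\<beta> (gen r s)) (\<alpha> (gen u v)) | r s u v.
       {x + y | x y. x \<in> rat_interval r s \<and> y \<in> rat_interval u v} \<subseteq> rat_interval p q}" (is "?A \<alpha> \<beta> p q \<subseteq> ?B p q")
    for \<alpha> \<beta> :: "reals_frame \<Rightarrow> 'a" and p q
  proof
    fix z assume "z \<in> ?A \<alpha> \<beta> p q"
    then obtain r s u v where z: "z = inf (\<alpha> (gen r s)) (\<beta> (gen u v))"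
      and sub: "{x + y | x y. x \<in> rat_interval r s \<and> y \<in> rat_interval u v} \<subseteq> rat_interval p q" by blast
    have "{x + y | x y. x \<in> rat_interval u v \<and> y \<in> rat_interval r s} \<subseteq> rat_interval p q"
      using sub by (force simp: add.commute)
    moreover have "z = inf (\<beta> (gen u v)) (\<alpha> (gen r s))"
      unfolding z by (rule inf.commute)
    ultimately show "z \<in> ?B p q" by blast
  qed
  then show ?thesis
    unfolding add_fun_def lift_op_def
    by (intro arg_cong[of _ _ hom_of] ext arg_cong[of _ _ Sup] antisym)
qed

text \<open>Evaluation at \<open>r\<close> after \<open>shift (- r)\<close> is evaluation at
  \<open>0\<close>, so \<open>const_fun (- r)\<close> is an inverse. Uniqueness, as the definite
  description demands, holds because \<open>shift r\<close> is invertible.\<close>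

lemma neg_fun_const: "neg_fun (const_fun r) = (const_fun (- r) :: reals_frame \<Rightarrow> 'a::frame)"
  unfolding neg_fun_def
proof (rule the_equality)
  have "point_hom r (shift (- r) U) = (point_hom 0 U :: 'a)" for U
    by (simp add: point_hom_def pts_shift)
  then have "(\<lambda>U. const_fun r (shift (- r) U)) = (const_fun 0 :: reals_frame \<Rightarrow> 'a)"
    by (simp add: const_fun_eq fun_eq_iff)
  moreover have "add_fun (const_fun r) (const_fun (- r)) = (\<lambda>U. const_fun r (shift (- r) U) :: 'a)"
    by (rule add_fun_const) (simp add: const_fun_eq frame_hom_point_hom)
  ultimately have "add_fun (const_fun r) (const_fun (- r)) = (const_fun 0 :: reals_frame \<Rightarrow> 'a)"
    by simp
  then show "const_fun (- r) \<in> real_functions \<and>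
      add_fun (const_fun r) (const_fun (- r)) = (const_fun 0 :: reals_frame \<Rightarrow> 'a)"
    by (simp add: real_functions_def const_fun_eq frame_hom_point_hom)
next
  fix \<gamma> :: "reals_frame \<Rightarrow> 'a"
  assume "\<gamma> \<in> real_functions \<and> add_fun (const_fun r) \<gamma> = const_fun 0"
  then have "frame_hom \<gamma>" and "add_fun \<gamma> (const_fun r) = const_fun 0"
    by (simp_all add: real_functions_def add_fun_commute)
  then have *: "\<gamma> (shift r U) = point_hom 0 U" for U
    using add_fun_const[of \<gamma> r] const_fun_eq[of 0, where ?'a = 'a] by metis
  have "\<gamma> U = point_hom (- r) U" for U
    using *[of "shift (- r) U"] by (simp add: shift_shift shift_0 point_hom_def pts_shift)
  then show "\<gamma> = const_fun (- r)" unfolding const_fun_eq by blast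
qed

section \<open>Cozero elements of translates and the set \<open>R_set\<close>\<close>

lemma coz_eq:
  assumes "frame_hom \<alpha>"
  shows "coz \<alpha> = \<alpha> (of_open (- {0}))"
proof -
  have "pts (sup (lower_ray 0) (upper_ray 0)) = pts (lower_ray 0) \<union> pts (upper_ray 0)"
    using pts_Sup[of "{lower_ray 0, upper_ray 0}"] by simp
  also have "\<dots> = - {0}"
    unfolding pts_lower_ray pts_upper_ray by auto
  finally have "sup (lower_ray 0) (upper_ray 0) = of_open (- {0})"
    using of_open_pts[of "sup (lower_ray 0) (upper_ray 0)"] by simp
  then show ?thesis
    unfolding coz_def frame_hom_sup[OF assms, symmetric] by simp
qed

text \<open>Subtracting \<open>r\<close> is composing with \<open>shift (- r)\<close>, which sends
  the complement of \<open>0\<close> to the complement of \<open>r\<close>. This turns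
  \<open>R_set\<close> into a condition on the values of \<open>\<alpha>\<close> itself.\<close>

lemma coz_diff_const:
  assumes "frame_hom \<alpha>"
  shows "coz (diff_fun \<alpha> (const_fun r)) = \<alpha> (of_open (- {r}))"
proof -
  have "open (- {0 :: real})" by auto
  then have "shift (- r) (of_open (- {0})) = of_open (- {r})"
    by (auto simp: shift_def pts_of_open intro!: arg_cong[of _ _ of_open])
  then show ?thesis
    unfolding diff_fun_def neg_fun_const add_fun_const[OF assms]
    by (simp add: coz_eq frame_hom_comp[OF assms frame_hom_shift])
qed

lemma R_set_eq: "frame_hom \<alpha> \<Longrightarrow> R_set \<alpha> = {r. \<alpha> (of_open (- {r})) \<noteq> top}"
  by (simp add: R_set_def coz_diff_const)

section \<open>Countable joins of complemented elements\<close>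

lemma inf_Sup_Sup_frame:
  "inf (Sup A) (Sup B) = Sup ((\<lambda>(a, b). inf a b) ` (A \<times> B))" for A B :: "'a::frame set"
proof (rule antisym)
  have "inf a (Sup B) \<le> Sup ((\<lambda>(a, b). inf a b) ` (A \<times> B))" if "a \<in> A" for a
    unfolding inf_Sup_frame using that by (intro Sup_subset_mono) auto
  then have "inf (Sup B) a \<le> Sup ((\<lambda>(a, b). inf a b) ` (A \<times> B))" if "a \<in> A" for a
    using that by (simp add: inf.commute)
  then show "inf (Sup A) (Sup B) \<le> Sup ((\<lambda>(a, b). inf a b) ` (A \<times> B))"
    unfolding inf.commute[of "Sup A"] inf_Sup_frame[of "Sup B"] by (auto intro!: Sup_least)
  show "Sup ((\<lambda>(a, b). inf a b) ` (A \<times> B)) \<le> inf (Sup A) (Sup B)"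
    by (rule Sup_least) (auto intro: le_infI1 le_infI2 Sup_upper)
qed

definition is_compl :: "'a::frame \<Rightarrow> 'a \<Rightarrow> bool" where
  "is_compl a b \<longleftrightarrow> inf a b = bot \<and> sup a b = top"

lemma is_compl_sym: "is_compl a b \<Longrightarrow> is_compl b a"
  by (simp add: is_compl_def inf.commute sup.commute)

lemma is_compl_bot_top: "is_compl bot top"
  by (simp add: is_compl_def)

lemma is_compl_inf_sup:
  assumes "is_compl a a'" "is_compl b b'"
  shows "is_compl (inf a b) (sup a' b')"
proof -
  have "inf (inf a b) a' = bot" "inf (inf a b) b' = bot"
    using assms unfolding is_compl_def
    by (metis inf.assoc inf.commute inf_bot_left, metis inf.assoc inf_bot_right)
  moreover have "sup a (sup a' b') = top" "sup b (sup a' b') = top"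
    using assms unfolding is_compl_def
    by (metis sup.assoc sup_top_left, metis sup.left_commute sup_top_right)
  ultimately show ?thesis
    by (simp add: is_compl_def inf_sup_distrib1 sup_inf_distrib2)
qed

lemma is_compl_sup_inf: "is_compl a a' \<Longrightarrow> is_compl b b' \<Longrightarrow> is_compl (sup a b) (inf a' b')"
  by (meson is_compl_inf_sup is_compl_sym)

lemma is_compl_antimono:
  assumes "is_compl a a'" "is_compl b b'" "a \<le> b"
  shows "b' \<le> a'"
proof -
  have "inf b' a = bot"
  proof (rule antisym)
    have "inf b' a \<le> inf b' b" using assms(3) by (intro inf_mono order_refl)
    also have "\<dots> = bot" using assms(2) by (simp add: is_compl_def inf.commute)
    finally show "inf b' a \<le> bot" .
  qed simp
  moreover have "inf b' (sup a a') = b'"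
    using assms(1) by (simp add: is_compl_def)
  ultimately have "b' = inf b' a'"
    by (simp add: inf_sup_distrib1)
  then show ?thesis by (metis inf_le2)
qed

definition sigma_compl :: "'a::frame set" where
  "sigma_compl = {Sup C | C. countable C \<and> (\<forall>c\<in>C. \<exists>c'. is_compl c c')}"

lemma is_compl_mem_sigma_compl: "is_compl c c' \<Longrightarrow> c \<in> sigma_compl"
  unfolding sigma_compl_def by (intro CollectI exI[of _ "{c}"]) auto

lemma Sup_mem_sigma_compl:
  assumes "countable S" "S \<subseteq> sigma_compl"
  shows "Sup S \<in> sigma_compl"
proof -
  have "\<forall>s\<in>S. \<exists>C. s = Sup C \<and> countable C \<and> (\<forall>c\<in>C. \<exists>c'. is_compl c c')"
    using assms(2) unfolding sigma_compl_def by blast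
  then obtain C where C: "\<And>s. s \<in> S \<Longrightarrow> s = Sup (C s)" "\<And>s. s \<in> S \<Longrightarrow> countable (C s)"
    "\<And>s c. s \<in> S \<Longrightarrow> c \<in> C s \<Longrightarrow> \<exists>c'. is_compl c c'"
    by metis
  have "Sup S = Sup (\<Union>s\<in>S. C s)"
  proof (rule antisym)
    show "Sup S \<le> Sup (\<Union>s\<in>S. C s)"
    proof (rule Sup_least)
      fix s assume "s \<in> S"
      then have "Sup (C s) \<le> Sup (\<Union>s\<in>S. C s)" by (intro Sup_subset_mono) auto
      then show "s \<le> Sup (\<Union>s\<in>S. C s)" using C(1)[OF \<open>s \<in> S\<close>] by simp
    qed
    show "Sup (\<Union>s\<in>S. C s) \<le> Sup S"
    proof (rule Sup_least)
      fix c assume "c \<in> (\<Union>s\<in>S. C s)"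
      then obtain s where "s \<in> S" "c \<in> C s" by blast
      then show "c \<le> Sup S" by (metis C(1) Sup_upper order_trans)
    qed
  qed
  moreover have "countable (\<Union>s\<in>S. C s)" using assms(1) C(2) by auto
  ultimately show ?thesis
    unfolding sigma_compl_def using C(3) by blast
qed

lemma inf_mem_sigma_compl:
  assumes "a \<in> sigma_compl" "b \<in> sigma_compl"
  shows "inf a b \<in> sigma_compl"
proof -
  obtain A B where "a = Sup A" "countable A" "\<forall>c\<in>A. \<exists>c'. is_compl c c'"
    "b = Sup B" "countable B" "\<forall>c\<in>B. \<exists>c'. is_compl c c'"
    using assms unfolding sigma_compl_def by blast
  then show ?thesis
    unfolding sigma_compl_def
    by (intro CollectI exI[of _ "(\<lambda>(a, b). inf a b) ` (A \<times> B)"])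
      (auto simp: inf_Sup_Sup_frame dest!: bspec intro: is_compl_inf_sup)
qed

text \<open>Partial joins of an enumeration are complemented by the partial meets of the
  complements. The start at \<open>bot\<close> ensures later that the successive differences of
  \<open>c\<close> have join \<open>a\<close>.\<close>

lemma sigma_complE:
  assumes "a \<in> sigma_compl"
  obtains c c' where "mono c" "c 0 = bot" "\<And>n :: nat. is_compl (c n) (c' n)" "a = Sup (range c)"
proof -
  obtain C where C: "a = Sup C" "countable C" "\<forall>c\<in>C. \<exists>c'. is_compl c c'"
    using assms unfolding sigma_compl_def by blast
  \<comment> \<open>Inserting \<open>bot\<close> makes the set nonempty, so that it has an
    enumeration even when \<open>C\<close> is empty.\<close>
  define e where "e = from_nat_into (insert bot C)"
  have e: "range e = insert bot C"
    unfolding e_def by (rule range_from_nat_into) (use C in auto)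
  have "\<exists>f'. is_compl (e n) f'" for n
    using C(3) is_compl_bot_top e by (metis insertE rangeI)
  then obtain f where f: "\<And>n. is_compl (e n) (f n)" by metis
  define c where "c = rec_nat bot (\<lambda>n y. sup y (e n))"
  define c' where "c' = rec_nat top (\<lambda>n y. inf y (f n))"
  have c: "c 0 = bot" "\<And>n. c (Suc n) = sup (c n) (e n)" by (simp_all add: c_def)
  have "is_compl (c n) (c' n)" for n
    by (induction n) (auto simp: c'_def c is_compl_bot_top intro: is_compl_sup_inf f)
  moreover have "mono c"
    by (simp add: mono_iff_le_Suc c)
  moreover have "a = Sup (range c)"
  proof (rule antisym)
    have "x \<le> Sup (range c)" if "x \<in> C" for x
    proof -
      have "x \<in> range e" using that e by simp
      then obtain n where "x = e n" by blast
      then have "x \<le> c (Suc n)" by (simp add: c)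
      also have "\<dots> \<le> Sup (range c)" by (rule Sup_upper) simp
      finally show ?thesis .
    qed
    then show "a \<le> Sup (range c)" unfolding C(1) by (rule Sup_least)
    have "e n \<in> insert bot C" for n
      unfolding e[symmetric] by simp
    then have "e n \<le> a" for n
      unfolding C(1) by (metis Sup_upper bot_least insertE)
    then have "c n \<le> a" for n by (induction n) (auto simp: c)
    then show "Sup (range c) \<le> a" by (auto intro: Sup_least)
  qed
  ultimately show thesis using that c(1) by blast
qed

text \<open>With increasing sequences \<open>c\<close> and \<open>d\<close> for \<open>a\<close> and
  \<open>b\<close>, take for \<open>u\<close> the join of the differences \<open>d n - c n\<close>
  and for \<open>v\<close> the join of the differences \<open>c n - d n\<close>.\<close>

lemma sigma_compl_normal:
  assumes "a \<in> sigma_compl" "b \<in> sigma_compl" "sup a b = top"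
  obtains u v where "u \<in> sigma_compl" "v \<in> sigma_compl"
    "sup a u = top" "sup v b = top" "inf u v = bot"
proof -
  obtain c c' :: "nat \<Rightarrow> _" where c: "mono c" "\<And>n. is_compl (c n) (c' n)" "a = Sup (range c)"
    using sigma_complE[OF assms(1)] by blast
  obtain d d' :: "nat \<Rightarrow> _" where d: "mono d" "\<And>n. is_compl (d n) (d' n)" "b = Sup (range d)"
    using sigma_complE[OF assms(2)] by blast
  let ?u = "Sup (range (\<lambda>n. inf (d n) (c' n)))" and ?v = "Sup (range (\<lambda>n. inf (c n) (d' n)))"
  have mem: "inf x y' \<in> sigma_compl" if "is_compl x x'" "is_compl y y'" for x x' y y' :: 'a
    by (meson inf_mem_sigma_compl is_compl_mem_sigma_compl is_compl_sym that)
  have le: "y \<le> sup x (inf y x')" if "is_compl x x'" for x x' y :: 'a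
    using that unfolding is_compl_def by (metis inf_le1 inf_sup_ord(3) inf_top.right_neutral le_sup_iff sup_ge2 sup_inf_distrib1)
  show thesis
  proof
    show "?u \<in> sigma_compl" "?v \<in> sigma_compl"
      using c(2) d(2) by (auto intro!: Sup_mem_sigma_compl mem)
    have "d n \<le> sup a ?u" for n
    proof -
      have "d n \<le> sup (c n) (inf (d n) (c' n))" by (rule le[OF c(2)])
      also have "\<dots> \<le> sup a ?u" unfolding c(3) by (intro sup_mono Sup_upper) auto
      finally show ?thesis .
    qed
    then have "b \<le> sup a ?u" unfolding d(3) by (auto intro: Sup_least)
    then show "sup a ?u = top" using assms(3) by (metis le_sup_iff sup_ge1 top.extremum_unique)
    have "c n \<le> sup b ?v" for n
    proof -
      have "c n \<le> sup (d n) (inf (c n) (d' n))" by (rule le[OF d(2)])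
      also have "\<dots> \<le> sup b ?v" unfolding d(3) by (intro sup_mono Sup_upper) auto
      finally show ?thesis .
    qed
    then have "a \<le> sup b ?v" unfolding c(3) by (auto intro: Sup_least)
    then show "sup ?v b = top" using assms(3) by (metis le_sup_iff sup.commute sup_ge1 top.extremum_unique)
    \<comment> \<open>The larger index decides: for \<open>m \<le> n\<close> the element
      \<open>c m\<close> lies below \<open>c n\<close>, which is disjoint from \<open>c' n\<close>;
      otherwise \<open>d n\<close> lies below \<open>d m\<close>, which is disjoint from
      \<open>d' m\<close>.\<close>
    have "inf (inf (d n) (c' n)) (inf (c m) (d' m)) = bot" for n m
    proof (cases "m \<le> n")
      case True
      then have "inf (inf (d n) (c' n)) (inf (c m) (d' m)) \<le> inf (c n) (c' n)"
        using monoD[OF c(1)] by (meson inf.boundedI inf.coboundedI1 inf.coboundedI2 inf_le1 inf_le2 order_trans)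
      then show ?thesis using c(2) by (metis bot.extremum_unique is_compl_def)
    next
      case False
      then have "n \<le> m" by simp
      then have "inf (inf (d n) (c' n)) (inf (c m) (d' m)) \<le> inf (d m) (d' m)"
        using monoD[OF d(1)] by (meson inf.boundedI inf.coboundedI1 inf.coboundedI2 inf_le1 inf_le2 order_trans)
      then show ?thesis using d(2) by (metis bot.extremum_unique is_compl_def)
    qed
    then show "inf ?u ?v = bot"
      unfolding inf_Sup_Sup_frame by (intro antisym Sup_least) auto
  qed
qed

text \<open>Each of \<open>inf x y\<close> and \<open>sup x' y\<close> can be recovered from the
  other. This is perfect normality for a complemented element, with a constant sequence.\<close>

lemma is_compl_inf_eq_iff:
  assumes "is_compl x x'"
  shows "inf x b = inf x c \<longleftrightarrow> sup x' b = sup x' c"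
proof
  have "sup x' y = sup x' (inf x y)" for y
    using assms by (metis inf_top_left is_compl_def sup.commute sup_inf_distrib1)
  then show "inf x b = inf x c \<Longrightarrow> sup x' b = sup x' c" by metis
  have "inf x y = inf x (sup x' y)" for y
    using assms by (metis inf_sup_distrib1 is_compl_def sup_bot_left)
  then show "sup x' b = sup x' c \<Longrightarrow> inf x b = inf x c" by metis
qed

text \<open>Take the complements \<open>c' n\<close> of an increasing sequence for \<open>a\<close>:
  two elements have the same meet with \<open>a\<close> iff they have the same meet with every
  \<open>c n\<close>.\<close>

lemma sigma_compl_perfect:
  assumes "a \<in> sigma_compl"
  obtains x :: "nat \<Rightarrow> 'a::frame" where "\<And>n. x n \<in> sigma_compl"
    "\<And>b c. inf a b = inf a c \<longleftrightarrow> (\<forall>n. sup (x n) b = sup (x n) c)"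
proof -
  obtain c c' :: "nat \<Rightarrow> _" where c: "\<And>n. is_compl (c n) (c' n)" "a = Sup (range c)"
    using sigma_complE[OF assms] by blast
  have "inf a y = inf a z \<longleftrightarrow> (\<forall>n. inf (c n) y = inf (c n) z)" for y z
  proof
    have "inf (c n) y = inf (c n) (inf a y)" for n y
      by (metis Sup_upper c(2) inf.absorb1 inf.assoc rangeI)
    then show "inf a y = inf a z \<Longrightarrow> \<forall>n. inf (c n) y = inf (c n) z" by metis
    have "inf a y = Sup (range (\<lambda>n. inf (c n) y))" for y
      unfolding c(2) inf.commute[of _ y] inf_Sup_frame image_image ..
    then show "\<forall>n. inf (c n) y = inf (c n) z \<Longrightarrow> inf a y = inf a z" by simp
  qed
  then have "inf a y = inf a z \<longleftrightarrow> (\<forall>n. sup (c' n) y = sup (c' n) z)" for y z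
    by (simp add: is_compl_inf_eq_iff[OF c(1)])
  moreover have "c' n \<in> sigma_compl" for n
    using c(1) is_compl_mem_sigma_compl is_compl_sym by blast
  ultimately show thesis using that by blast
qed

section \<open>Cozero elements of functions with countable image\<close>

lemma coz_C_c_mem_sigma_compl:
  fixes \<alpha> :: "reals_frame \<Rightarrow> 'a::frame"
  assumes "\<alpha> \<in> C_c"
  shows "coz \<alpha> \<in> sigma_compl"
proof -
  have \<alpha>: "frame_hom \<alpha>" and R: "countable (R_set \<alpha>)"
    using assms by (auto simp: C_c_def real_functions_def)
  \<comment> \<open>\<open>r \<notin> R_set \<alpha>\<close> says that \<open>\<alpha>\<close> sends
    the complement of \<open>r\<close> to \<open>top\<close>; that complement is the disjoint union
    of the two rays.\<close>
  have compl: "is_compl (\<alpha> (of_open {r<..})) (\<alpha> (of_open {..<r}))" if "r \<notin> R_set \<alpha>" for r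
  proof -
    have "{r<..} \<inter> {..<r} = {}" "{r<..} \<union> {..<r} = - {r}" by auto
    then have "inf (of_open {r<..}) (of_open {..<r}) = bot"
      "sup (of_open {r<..}) (of_open {..<r}) = of_open (- {r})"
      by (simp_all add: of_open_empty flip: of_open_Int of_open_Un)
    moreover have "\<alpha> (of_open (- {r})) = top" using that by (simp add: R_set_eq[OF \<alpha>])
    ultimately show ?thesis
      by (simp add: is_compl_def frame_hom_bot[OF \<alpha>] flip: frame_hom_inf[OF \<alpha>] frame_hom_sup[OF \<alpha>])
  qed
  \<comment> \<open>A countable set contains no nonempty open interval.\<close>
  have ex: "\<exists>r\<in>{a<..<b}. r \<notin> R_set \<alpha>" if "a < b" for a b
    using uncountable_open_interval[of a b] that countable_subset[OF _ R] by blast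
  have "\<exists>r. 0 < r \<and> r < 1 / real (Suc n) \<and> r \<notin> R_set \<alpha>" for n
    using ex[of 0 "1 / real (Suc n)"] by auto
  then obtain r where r: "\<And>n. 0 < r n" "\<And>n. r n < 1 / real (Suc n)" "\<And>n. r n \<notin> R_set \<alpha>" by metis
  have "\<exists>s. - (1 / real (Suc n)) < s \<and> s < 0 \<and> s \<notin> R_set \<alpha>" for n
    using ex[of "- (1 / real (Suc n))" 0] by auto
  then obtain s where s: "\<And>n. s n < 0" "\<And>n. - (1 / real (Suc n)) < s n" "\<And>n. s n \<notin> R_set \<alpha>" by metis
  \<comment> \<open>The cut points \<open>r n > 0\<close> and \<open>s n < 0\<close> tend to
    \<open>0\<close>, so these rays cover exactly the nonzero reals.\<close>
  let ?\<A> = "range (\<lambda>n. {r n<..}) \<union> range (\<lambda>n. {..<s n})"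
  have "x \<in> \<Union>?\<A>" if x: "x \<noteq> 0" for x
  proof -
    obtain n where n: "1 / real (Suc n) < \<bar>x\<bar>"
      using reals_Archimedean[of "\<bar>x\<bar>"] x by (auto simp: inverse_eq_divide)
    then have "r n < x \<or> x < s n" using r(2)[of n] s(2)[of n] by linarith
    then show ?thesis by blast
  qed
  moreover have "\<not> r n < 0" "\<not> 0 < s n" for n
    using r(1)[of n] s(1)[of n] by linarith+
  then have "0 \<notin> \<Union>?\<A>" by auto
  ultimately have "\<Union>?\<A> = - {0}" by blast
  moreover have "of_open (\<Union>?\<A>) = Sup (of_open ` ?\<A>)"
    by (rule of_open_Union) auto
  ultimately have "coz \<alpha> = Sup (\<alpha> ` of_open ` ?\<A>)"
    by (metis coz_eq[OF \<alpha>] frame_hom_Sup[OF \<alpha>])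
  moreover have "\<exists>c'. is_compl c c'" if "c \<in> \<alpha> ` of_open ` ?\<A>" for c
    using that compl[OF r(3)] is_compl_sym[OF compl[OF s(3)]] by auto
  moreover have "countable (\<alpha> ` of_open ` ?\<A>)" by simp
  ultimately show ?thesis
    unfolding sigma_compl_def by (intro CollectI exI[of _ "\<alpha> ` of_open ` ?\<A>"]) simp
qed

text \<open>Conversely, write \<open>a\<close> as the join of an increasing sequence \<open>c\<close> of complemented elements. The
  function taking the value \<open>1 / (n + 1)\<close> on \<open>c (n + 1) - c n\<close> and \<open>0\<close> off \<open>a\<close> has cozero element \<open>a\<close>.
  As \<open>a\<close> need not be complemented, the neighbourhoods of \<open>0\<close> are described through the
  complements \<open>c' N\<close>, on which the values are \<open>0\<close> or \<open>1 / (n + 1)\<close> with \<open>n \<ge> N\<close>.\<close>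

lemma sigma_compl_is_coz:
  assumes "a \<in> sigma_compl"
  shows "a \<in> coz ` (C_c :: (reals_frame \<Rightarrow> 'a::frame) set)"
proof -
  obtain c c' :: "nat \<Rightarrow> 'a" where c: "mono c" "c 0 = bot" "\<And>n. is_compl (c n) (c' n)" "a = Sup (range c)"
    using sigma_complE[OF assms] by blast
  define d where "d n = inf (c (Suc n)) (c' n)" for n
  define t where "t n = inverse (real (Suc n))" for n
  define S where "S U = d ` {n. t n \<in> pts U} \<union> c' ` {N. 0 \<in> pts U \<and> (\<forall>n\<ge>N. t n \<in> pts U)}" for U
  define \<alpha> where "\<alpha> U = Sup (S U)" for U
  have t: "t \<longlonglongrightarrow> 0" "t n \<noteq> 0" for n
    unfolding t_def using LIMSEQ_inverse_real_of_nat by simp_all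
  \<comment> \<open>Hence \<open>\<alpha> U = top\<close> as soon as \<open>U\<close> contains
    \<open>0\<close> and all \<open>t n\<close>.\<close>
  have c'0: "c' 0 = top"
    using c(3)[of 0] by (simp add: c(2) is_compl_def)
  have c'_anti: "c' m \<le> c' n" if "n \<le> m" for m n
    using is_compl_antimono[OF c(3) c(3) monoD[OF c(1) that]] .
  have cc': "inf (c n) (c' n) = bot" "sup (c n) (c' n) = top" for n
    using c(3) by (simp_all add: is_compl_def)
  have c_Suc: "c (Suc n) = sup (c n) (d n)" for n
    using monoD[OF c(1), of n "Suc n"] by (simp add: d_def sup_inf_distrib1 cc' sup.absorb2)
  \<comment> \<open>What lies off \<open>c n\<close> lies in the next difference or off
    \<open>c (Suc n)\<close>.\<close>
  have c'_Suc: "c' n = sup (d n) (c' (Suc n))" for n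
    using c'_anti[of n "Suc n"] by (simp add: d_def sup_inf_distrib2 cc' sup.absorb1)
  have d_c': "inf (d n) (c' N) = bot" if "n < N" for n N
  proof -
    have "inf (d n) (c' N) \<le> inf (c N) (c' N)"
      unfolding d_def using monoD[OF c(1), of "Suc n" N] that by (meson Suc_leI inf_mono le_infI1 order_refl)
    then show ?thesis by (simp add: cc' bot.extremum_unique)
  qed
  have d_le: "d n \<le> c' n" for n by (simp add: d_def)
  have d_d: "inf (d n) (d m) = bot" if "n \<noteq> m" for n m
    using that
  proof (induction n m rule: linorder_wlog)
    case (le n m)
    then have "inf (d n) (d m) \<le> inf (d n) (c' m)" using d_le by (meson inf_mono order_refl)
    then show ?case using d_c'[of n m] le by (simp add: bot.extremum_unique)
  next
    case (sym n m)
    then show ?case by (simp add: inf.commute)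
  qed
  have mono: "\<alpha> U \<le> \<alpha> V" if "U \<le> V" for U V
  proof -
    have "pts U \<subseteq> pts V" using that by (simp add: pts_subset_iff)
    then have "S U \<subseteq> S V" unfolding S_def by blast
    then show ?thesis unfolding \<alpha>_def by (rule Sup_subset_mono)
  qed
  have top: "\<alpha> top = top"
  proof (rule top_le)
    have "c' 0 \<in> S top" by (auto simp: S_def pts_top)
    then show "top \<le> \<alpha> top" unfolding \<alpha>_def c'0 by (rule Sup_upper)
  qed
  have inf: "\<alpha> (inf U V) = inf (\<alpha> U) (\<alpha> V)" for U V
  proof (rule antisym)
    show "\<alpha> (inf U V) \<le> inf (\<alpha> U) (\<alpha> V)" by (simp add: mono)
    \<comment> \<open>For \<open>n < N\<close> the two elements are disjoint; for
      \<open>n \<ge> N\<close> the value \<open>t n\<close> lies in both sets, so \<open>d n\<close>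
      itself is one of the joined elements.\<close>
    have dc: "inf (d n) (c' N) \<le> \<alpha> (inf U V)" if "t n \<in> pts U" "\<forall>n\<ge>N. t n \<in> pts V" for n N U V
    proof (cases "n < N")
      case True
      then show ?thesis by (simp add: d_c')
    next
      case False
      then have "d n \<in> S (inf U V)" using that by (auto simp: S_def pts_inf)
      then show ?thesis unfolding \<alpha>_def by (meson Sup_upper le_infI1)
    qed
    have "inf x y \<le> \<alpha> (inf U V)" if xy: "x \<in> S U" "y \<in> S V" for x y
    proof -
      consider n m where "x = d n" "t n \<in> pts U" "y = d m" "t m \<in> pts V"
        | n N where "x = d n" "t n \<in> pts U" "y = c' N" "\<forall>n\<ge>N. t n \<in> pts V"
        | n N where "y = d n" "t n \<in> pts V" "x = c' N" "\<forall>n\<ge>N. t n \<in> pts U"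
        | N M where "x = c' N" "0 \<in> pts U" "\<forall>n\<ge>N. t n \<in> pts U" "y = c' M" "0 \<in> pts V" "\<forall>n\<ge>M. t n \<in> pts V"
        using xy unfolding S_def by blast
      then show ?thesis
      proof cases
        case 1
        show ?thesis
        proof (cases "n = m")
          case True
          with 1 have "d n \<in> S (inf U V)" by (auto simp: S_def pts_inf)
          with 1 True show ?thesis unfolding \<alpha>_def by (simp add: Sup_upper)
        qed (use 1 d_d in simp)
      next
        case 2
        then show ?thesis using dc by simp
      next
        case 3
        then show ?thesis using dc[of n V N U] by (simp add: inf.commute)
      next
        case 4
        then have "c' (max N M) \<in> S (inf U V)" by (auto simp: S_def pts_inf)
        moreover have "inf x y \<le> c' (max N M)"
          using 4 by (simp add: max_def)
        ultimately show ?thesis unfolding \<alpha>_def by (meson Sup_upper order_trans)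
      qed
    qed
    then show "inf (\<alpha> U) (\<alpha> V) \<le> \<alpha> (inf U V)"
      unfolding \<alpha>_def[of U] \<alpha>_def[of V] inf_Sup_Sup_frame by (intro Sup_least) auto
  qed
  have Sup: "\<alpha> (Sup A) = Sup (\<alpha> ` A)" for A
  proof (rule antisym)
    show "Sup (\<alpha> ` A) \<le> \<alpha> (Sup A)" by (auto intro!: Sup_least mono Sup_upper)
    have S_le: "x \<le> Sup (\<alpha> ` A)" if "x \<in> S U" "U \<in> A" for x U
    proof -
      have "x \<le> \<alpha> U" unfolding \<alpha>_def by (rule Sup_upper) fact
      also have "\<dots> \<le> Sup (\<alpha> ` A)" using that by (intro Sup_upper) simp
      finally show ?thesis .
    qed
    have d_le_Sup: "d n \<le> Sup (\<alpha> ` A)" if "t n \<in> pts (Sup A)" for n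
      using that S_le[of "d n"] unfolding pts_Sup by (auto simp: S_def)
    \<comment> \<open>The tail of \<open>t\<close> from \<open>N\<close> on may be spread over
      several members of \<open>A\<close>. The member \<open>U\<close> containing \<open>0\<close>
      contains the tail from some \<open>M\<close> on, which bounds \<open>c' (max N M)\<close>;
      descending from there to \<open>N\<close> adds one bounded \<open>d k\<close> at a
      time.\<close>
    have "c' N \<le> Sup (\<alpha> ` A)" if N: "0 \<in> pts (Sup A)" "\<forall>n\<ge>N. t n \<in> pts (Sup A)" for N
    proof -
      obtain U where U: "U \<in> A" "0 \<in> pts U" using N(1) unfolding pts_Sup by blast
      then obtain M where M: "\<forall>n\<ge>M. t n \<in> pts U"
        using topological_tendstoD[OF t(1) open_pts U(2)] unfolding eventually_sequentially by blast
      have "N \<le> max N M" by simp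
      then show ?thesis
      proof (induction rule: inc_induct)
        case base
        have "c' (max N M) \<in> S U" using M U by (auto simp: S_def)
        then show ?case using S_le U(1) by blast
      next
        case (step k)
        then show ?case using c'_Suc[of k] d_le_Sup N(2) by simp
      qed
    qed
    with d_le_Sup show "\<alpha> (Sup A) \<le> Sup (\<alpha> ` A)"
      unfolding \<alpha>_def[of "Sup A"] by (intro Sup_least) (auto simp: S_def)
  qed
  have hom: "frame_hom \<alpha>"
    unfolding frame_hom_def using top inf Sup by blast
  have "R_set \<alpha> \<subseteq> insert 0 (range t)"
  proof
    fix r assume "r \<in> R_set \<alpha>"
    then have "\<alpha> (of_open (- {r})) \<noteq> c' 0" by (simp add: R_set_eq[OF hom] c'0)
    then have "c' 0 \<notin> S (of_open (- {r}))" unfolding \<alpha>_def c'0 by (metis Sup_upper top_le)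
    \<comment> \<open>Removing a point \<open>r\<close> that is neither \<open>0\<close> nor a value
      \<open>t n\<close> keeps all values, so \<open>N = 0\<close> is allowed.\<close>
    moreover have "c' 0 \<in> S (of_open (- {r}))" if "r \<notin> insert 0 (range t)"
    proof -
      have "open (- {r})" by auto
      then have "0 \<in> pts (of_open (- {r})) \<and> (\<forall>n\<ge>0. t n \<in> pts (of_open (- {r})))"
        using that by (auto simp: pts_of_open)
      then show ?thesis unfolding S_def by blast
    qed
    ultimately show "r \<in> insert 0 (range t)" by blast
  qed
  then have "countable (R_set \<alpha>)" by (rule countable_subset) simp
  then have "\<alpha> \<in> C_c"
    using hom by (simp add: C_c_def real_functions_def)
  moreover have "coz \<alpha> = a"
  proof -
    have "pts (of_open (- {0})) = - {0}" by (rule pts_of_open) auto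
    \<comment> \<open>Every \<open>t n\<close> is nonzero, so all \<open>d n\<close> occur;
      \<open>0\<close> is missing, so no \<open>c' N\<close> does.\<close>
    then have "S (of_open (- {0})) = range d"
      using t(2) by (auto simp: S_def)
    then have "coz \<alpha> = Sup (range d)" by (simp add: coz_eq[OF hom] \<alpha>_def)
    also have "\<dots> = a"
      unfolding c(4)
    proof (rule antisym)
      have "d n \<le> Sup (range c)" for n
        by (metis Sup_upper c_Suc le_sup_iff rangeI)
      then show "Sup (range d) \<le> Sup (range c)" by (auto intro: Sup_least)
      \<comment> \<open>Starting from \<open>c 0 = bot\<close>, each step joins one more
        difference.\<close>
      have "c n \<le> Sup (range d)" for n
        by (induction n) (auto simp: c(2) c_Suc intro: Sup_upper)
      then show "Sup (range c) \<le> Sup (range d)" by (auto intro: Sup_least)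
    qed
    finally show ?thesis .
  qed
  ultimately show ?thesis by blast
qed

lemma coz_image_C_c: "coz ` (C_c :: (reals_frame \<Rightarrow> 'a::frame) set) = sigma_compl"
  using coz_C_c_mem_sigma_compl sigma_compl_is_coz by blast

section \<open>Sub-\<open>\<sigma>\<close>-frames of a frame as explicit orders\<close>

definition suborder :: "'a::order set \<Rightarrow> 'a gorder" where
  "suborder B = \<lparr>carrier = B, eq = (=), le = (\<le>)\<rparr>"

lemma suborder_simps [simp]:
  "carrier (suborder B) = B" "eq (suborder B) = (=)" "le (suborder B) = (\<le>)"
  by (simp_all add: suborder_def)

lemma partial_order_suborder: "partial_order (suborder B)"
  by unfold_locales auto

text \<open>The record operations choose some least upper bound; antisymmetry leaves only one
  candidate.\<close>

lemma Sup_suborder_eqI: "least (suborder B) x (Upper (suborder B) S) \<Longrightarrow> \<Squnion>\<^bsub>suborder B\<^esub>S = x"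
  unfolding Lattice.sup_def
  by (rule some_equality) (auto simp: least_def intro: antisym)

lemma Inf_suborder_eqI: "greatest (suborder B) x (Lower (suborder B) S) \<Longrightarrow> \<Sqinter>\<^bsub>suborder B\<^esub>S = x"
  unfolding Lattice.inf_def
  by (rule some_equality) (auto simp: greatest_def intro: antisym)

context
  fixes B :: "'a::frame set"
  assumes Sup_closed: "\<And>S. countable S \<Longrightarrow> S \<subseteq> B \<Longrightarrow> Sup S \<in> B"
    and inf_closed: "\<And>x y. x \<in> B \<Longrightarrow> y \<in> B \<Longrightarrow> inf x y \<in> B"
    and top_closed: "top \<in> B"
begin

lemma least_suborder_Sup:
  "countable S \<Longrightarrow> S \<subseteq> B \<Longrightarrow> least (suborder B) (Sup S) (Upper (suborder B) S)"
  by (auto simp: least_def Upper_def Sup_closed intro: Sup_upper Sup_least)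

lemma greatest_suborder_inf:
  "x \<in> B \<Longrightarrow> y \<in> B \<Longrightarrow> greatest (suborder B) (inf x y) (Lower (suborder B) {x, y})"
  by (auto simp: greatest_def Lower_def inf_closed)

lemma suborder_Sup: "countable S \<Longrightarrow> S \<subseteq> B \<Longrightarrow> \<Squnion>\<^bsub>suborder B\<^esub>S = Sup S"
  by (intro Sup_suborder_eqI least_suborder_Sup)

lemma sup_closed: "x \<in> B \<Longrightarrow> y \<in> B \<Longrightarrow> sup x y \<in> B"
  using Sup_closed[of "{x, y}"] by simp

lemma bot_closed: "bot \<in> B"
  using Sup_closed[of "{}"] by simp

lemma suborder_join: "x \<in> B \<Longrightarrow> y \<in> B \<Longrightarrow> x \<squnion>\<^bsub>suborder B\<^esub> y = sup x y"
  unfolding join_def by (subst suborder_Sup) auto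

lemma suborder_meet: "x \<in> B \<Longrightarrow> y \<in> B \<Longrightarrow> x \<sqinter>\<^bsub>suborder B\<^esub> y = inf x y"
  unfolding meet_def by (intro Inf_suborder_eqI greatest_suborder_inf)

lemma suborder_top: "\<top>\<^bsub>suborder B\<^esub> = top"
  unfolding Order.top_def
  by (rule some_equality) (auto simp: greatest_def top_closed intro: top_le)

lemma suborder_bottom: "\<bottom>\<^bsub>suborder B\<^esub> = bot"
  unfolding bottom_def
  by (rule some_equality) (auto simp: least_def bot_closed intro: antisym)

lemma bounded_lattice_suborder: "bounded_lattice (suborder B)"
proof -
  interpret partial_order "suborder B" by (rule partial_order_suborder)
  show ?thesis
  proof unfold_locales
    show "\<exists>s. least (suborder B) s (Upper (suborder B) {x, y})"
      if "x \<in> carrier (suborder B)" "y \<in> carrier (suborder B)" for x y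
      using least_suborder_Sup[of "{x, y}"] that by auto
    show "\<exists>s. greatest (suborder B) s (Lower (suborder B) {x, y})"
      if "x \<in> carrier (suborder B)" "y \<in> carrier (suborder B)" for x y
      using greatest_suborder_inf that by auto
    show "\<exists>x. least (suborder B) x (carrier (suborder B))"
      using bot_closed by (auto simp: least_def intro!: exI[of _ bot])
    show "\<exists>x. greatest (suborder B) x (carrier (suborder B))"
      using top_closed by (auto simp: greatest_def intro!: exI[of _ top])
  qed
qed

text \<open>On \<open>B\<close> the record operations agree with those of the frame, so both
  distributive laws are inherited.\<close>

lemma sigma_frame_suborder: "sigma_frame (suborder B)"
  unfolding sigma_frame_def
proof (intro conjI ballI allI impI)
  show "Lattice.lattice (suborder B)"
    using bounded_lattice_suborder by (rule bounded_lattice.axioms)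
  show "a \<sqinter>\<^bsub>suborder B\<^esub> (b \<squnion>\<^bsub>suborder B\<^esub> c) =
      a \<sqinter>\<^bsub>suborder B\<^esub> b \<squnion>\<^bsub>suborder B\<^esub> a \<sqinter>\<^bsub>suborder B\<^esub> c"
    if "a \<in> carrier (suborder B)" "b \<in> carrier (suborder B)" "c \<in> carrier (suborder B)" for a b c
    using that by (simp add: suborder_join suborder_meet sup_closed inf_closed inf_sup_distrib1)
  show "\<exists>s. least (suborder B) s (Upper (suborder B) S)"
    if "S \<subseteq> carrier (suborder B)" "countable S" for S
    using least_suborder_Sup that by auto
  show "a \<sqinter>\<^bsub>suborder B\<^esub> \<Squnion>\<^bsub>suborder B\<^esub>S = \<Squnion>\<^bsub>suborder B\<^esub>((\<sqinter>\<^bsub>suborder B\<^esub>) a ` S)"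
    if aS: "a \<in> carrier (suborder B)" "S \<subseteq> carrier (suborder B)" "countable S" for a S
  proof -
    have "(\<sqinter>\<^bsub>suborder B\<^esub>) a ` S = inf a ` S"
      using aS by (intro image_cong) (auto simp: suborder_meet)
    moreover have "inf a ` S \<subseteq> B" using aS by (auto intro: inf_closed)
    ultimately show ?thesis
      using aS by (simp add: suborder_Sup suborder_meet Sup_closed inf_Sup_frame)
  qed
qed

end

section \<open>Transfer of the properties of \<open>sigma_compl\<close> to
  \<open>Coz_c\<close>\<close>

theorem mainTheorem4:
  assumes "completely_regular TYPE('a::frame)"
  shows "sigma_frame (Coz_c :: 'a gorder)
       \<and> normal_lattice (Coz_c :: 'a gorder)
       \<and> perfectly_normal (Coz_c :: 'a gorder)"
proof -
  let ?B = "sigma_compl :: 'a set"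
  have Coz_c: "Coz_c = suborder ?B"
    by (simp add: Coz_c_def suborder_def coz_image_C_c)
  have top: "top \<in> ?B"
    by (meson is_compl_bot_top is_compl_mem_sigma_compl is_compl_sym)
  \<comment> \<open>The closure assumptions, in the order in which the lemmas on
    \<open>suborder\<close> take them.\<close>
  note closed = Sup_mem_sigma_compl inf_mem_sigma_compl top
  note ops = suborder_join[OF closed] suborder_meet[OF closed] suborder_top[OF closed] suborder_bottom[OF closed]
  have sigma: "sigma_frame (suborder ?B)"
    by (rule sigma_frame_suborder[OF closed])
  have normal: "normal_lattice (suborder ?B)"
    unfolding normal_lattice_def
  proof (intro conjI ballI impI)
    show "bounded_lattice (suborder ?B)" by (rule bounded_lattice_suborder[OF closed])
    fix a b assume "a \<in> carrier (suborder ?B)" "b \<in> carrier (suborder ?B)"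
      "a \<squnion>\<^bsub>suborder ?B\<^esub> b = \<top>\<^bsub>suborder ?B\<^esub>"
    then have ab: "a \<in> ?B" "b \<in> ?B" "sup a b = top" by (simp_all add: ops)
    obtain u v where "u \<in> ?B" "v \<in> ?B" "sup a u = top" "sup v b = top" "inf u v = bot"
      using sigma_compl_normal[OF ab] .
    with ab show "\<exists>u\<in>carrier (suborder ?B). \<exists>v\<in>carrier (suborder ?B).
        a \<squnion>\<^bsub>suborder ?B\<^esub> u = \<top>\<^bsub>suborder ?B\<^esub> \<and> v \<squnion>\<^bsub>suborder ?B\<^esub> b = \<top>\<^bsub>suborder ?B\<^esub> \<and>
        u \<sqinter>\<^bsub>suborder ?B\<^esub> v = \<bottom>\<^bsub>suborder ?B\<^esub>"
      by (intro bexI[of _ u] bexI[of _ v]) (simp_all add: ops)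
  qed
  have "perfectly_normal (suborder ?B)"
    unfolding perfectly_normal_def
  proof (intro conjI sigma normal ballI)
    fix a assume "a \<in> carrier (suborder ?B)"
    then have a: "a \<in> ?B" by simp
    obtain x :: "nat \<Rightarrow> 'a" where "\<And>n. x n \<in> ?B"
      "\<And>b c. inf a b = inf a c \<longleftrightarrow> (\<forall>n. sup (x n) b = sup (x n) c)"
      using sigma_compl_perfect[OF a] by metis
    with a show "\<exists>x :: nat \<Rightarrow> 'a. (\<forall>n. x n \<in> carrier (suborder ?B)) \<and>
        (\<forall>b\<in>carrier (suborder ?B). \<forall>c\<in>carrier (suborder ?B).
          a \<sqinter>\<^bsub>suborder ?B\<^esub> b = a \<sqinter>\<^bsub>suborder ?B\<^esub> c \<longleftrightarrow>
          (\<forall>n. x n \<squnion>\<^bsub>suborder ?B\<^esub> b = x n \<squnion>\<^bsub>suborder ?B\<^esub> c))"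
      by (intro exI[of _ x]) (simp add: ops)
  qed
  with sigma normal show ?thesis unfolding Coz_c by blast
qed

end
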